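(* Let $\Gamma=\{\gamma_1,\ldots,\gamma_k\}$ be an admissible curve family on $\Sigma$. The surface of circumferences is well-defined on the Teichmüller space $\mathcal T$ of $\Sigma$: if $(S_1,f_1)=(S_2,f_2)$ in $\mathcal T$, then $\mathcal A(S_1,f_1(\Gamma))=\mathcal A(S_2,f_2(\Gamma))$.
   Context: Setting. $\Sigma$ is a Riemann surface of genus $g$ with $n$ punctures, $3g-3+n>0$. The Teichmüller space $\mathcal T$ of $\Sigma$ is the set of pairs $(S,f)$, with $S$ a Riemann surface and $f:\Sigma\to S$ a quasiconformal mapping, modulo the relation: $(S_1,f_1)\sim(S_2,f_2)$ iff there is a conformal mapping $h:S_1\to S_2$ homotopic to $f_2\circ f_1^{-1}$. The following definitions apply to any Riemann surface $X$ of genus $g$ with $n$ punctures. A holomorphic quadratic differential $\varphi=\varphi(z)dz^2$ on $X$ is always assumed to have finite norm $\|\varphi\|=\iint_X|\varphi(z)|\,dx\,dy$ (so it has at most simple poles at punctures). Critical points are its zeros and poles. A vertical trajectory of $\varphi\neq 0$ is a maximal analytic curve $\gamma(t)$ with $\varphi(\gamma(t))\gamma'(t)^2<0$; the critical graph $CT(\varphi)$ is the set of all critical points and all vertical trajectories joining critical points. $\varphi$ is a Jenkins-Strebel differential if every component of $X-CT(\varphi)$ is a ring domain swept out by closed vertical trajectories; these are its characteristic ring domains. The modulus of a ring domain is the ratio height/circumference of a conformally equivalent Euclidean cylinder; the modulus of the empty set is $0$. An admissible curve family $\Gamma=\{\gamma_1,\ldots,\gamma_k\}$ on $X$ is a finite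 set of non-trivial, non-peripheral, pairwise disjoint and pairwise non-homotopic simple closed curves. For $f:\Sigma\to S$ quasiconformal, $f(\Gamma)=\{f(\gamma_1),\ldots,f(\gamma_k)\}$. A ring domain is of type $\gamma$ if its core curve is homotopic to $\gamma$. A family $\{R_j\}_{j=1}^k$, where $R_j=\varnothing$ is allowed ("degenerated"), is of type $\Gamma$ if each non-empty $R_j$ is a ring domain of type $\gamma_j$. A Jenkins-Strebel differential is of type $\Gamma$ if its characteristic ring domains form (after adding empty sets) a family of type $\Gamma$. $JS(X,\Gamma)$ is the set of all Jenkins-Strebel differentials on $X$ of type $\Gamma$ together with the zero differential, and $JS_0(X,\Gamma)$ is the set of its elements of norm $1$. The map $F_{X,\Gamma}:\mathbf R_{\ge0}^k\to JS(X,\Gamma)$: for positive $A_1,\ldots,A_k$, $F_{X,\Gamma}(A_1,\ldots,A_k)$ is the unique Jenkins-Strebel differential $\varphi$ of type $\Gamma$ (it exists by a theorem of Strebel) whose characteristic ring domains $\{R_j\}$, with moduli $M_j$, maximize $\sum_j A_j^2\tilde M_j$ among all families $\{\tilde R_j\}$ of non-overlapping (possibly degenerated) ring domains of type $\Gamma$ with moduli $\tilde M_j$, and which satisfies $A_j=a_j$ if $M_j>0$ and $A_j\le a_j$ if $M_j=0$, where $a_j=\inf_{\gamma'\sim\gamma_j}\int_{\gamma'}|\varphi|^{1/2}$ (infimum over simple closed curves homotopic to $\gamma_j$). If some, but not all, $A_j$ are $0$, the corresponding curves are omitted from $\Gamma$ and the same definition is used; $F_{X,\Gamma}(0,\ldots,0)=0$.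 The surface of circumferences for $\Gamma$ on $X$ is $\mathcal A(X,\Gamma)=\{(A_1^2,\ldots,A_k^2)\in\mathbf R_{\ge0}^k\mid F_{X,\Gamma}(A_1,\ldots,A_k)\in JS_0(X,\Gamma)\}$.
   Formalization: Critical points are taken to be the zeros together with all punctures, including punctures where the differential is regular and non-zero; with only zeros and poles, the map F would be undefined, for example on a once-punctured torus. *)

theory Defs
  imports
    "HOL-Complex_Analysis.Complex_Analysis"
    "HOL-Homology.Homology"
begin

section \<open>Riemann surfaces\<close>

text \<open>A chart is a pair \<open>(U, z)\<close> of a domain and a coordinate function; only the values of \<open>z\<close>
  on \<open>U\<close> carry information.\<close>

type_synonym 'a chart = "'a set \<times> ('a \<Rightarrow> complex)"

record 'a surface =
  topol :: "'a topology"
  charts :: "'a chart set"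

abbreviation points :: "'a surface \<Rightarrow> 'a set" where
  "points X \<equiv> topspace (topol X)"

definition is_chart :: "'a topology \<Rightarrow> 'a chart \<Rightarrow> bool" where
  "is_chart T = (\<lambda>(U, z). openin T U \<and> open (z ` U) \<and>
     homeomorphic_map (subtopology T U) (top_of_set (z ` U)) z)"

text \<open>Coordinate change from the chart \<open>(U, z)\<close> to the chart \<open>(V, w)\<close>; it is meaningful on
  \<open>z ` (U \<inter> V)\<close>.\<close>

definition transition :: "'a chart \<Rightarrow> 'a chart \<Rightarrow> complex \<Rightarrow> complex" where
  "transition = (\<lambda>(U, z) (V, w). w \<circ> inv_into U z)"

definition compatible :: "'a chart \<Rightarrow> 'a chart \<Rightarrow> bool" where
  "compatible c d \<longleftrightarrow>
     transition c d holomorphic_on snd c ` (fst c \<inter> fst d) \<and>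
     transition d c holomorphic_on snd d ` (fst c \<inter> fst d)"

text \<open>The complex structure is given by its maximal atlas. Second countability is not demanded,
  since it is automatic (Rado).\<close>

definition riemann_surface :: "'a surface \<Rightarrow> bool" where
  "riemann_surface X \<longleftrightarrow>
     Hausdorff_space (topol X) \<and> connected_space (topol X) \<and> points X \<noteq> {} \<and>
     (\<forall>c\<in>charts X. is_chart (topol X) c) \<and>
     (\<Union>c\<in>charts X. fst c) = points X \<and>
     (\<forall>c\<in>charts X. \<forall>d\<in>charts X. compatible c d) \<and>
     (\<forall>c. is_chart (topol X) c \<and> (\<forall>d\<in>charts X. compatible c d) \<longrightarrow> c \<in> charts X)"

text \<open>Conformal mappings are biholomorphic; holomorphy of the inverse is automatic.\<close>

definition conformal_map :: "'a surface \<Rightarrow> 'b surface \<Rightarrow> ('a \<Rightarrow> 'b) \<Rightarrow> bool" where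
  "conformal_map X Y h \<longleftrightarrow> homeomorphic_map (topol X) (topol Y) h \<and>
     (\<forall>(U, z)\<in>charts X. \<forall>(V, w)\<in>charts Y.
        (w \<circ> h \<circ> inv_into U z) holomorphic_on z ` {p \<in> U. h p \<in> V})"

definition open_subsurface :: "'a surface \<Rightarrow> 'a set \<Rightarrow> 'a surface" where
  "open_subsurface X W =
     \<lparr>topol = subtopology (topol X) W, charts = {c \<in> charts X. fst c \<subseteq> W}\<rparr>"

text \<open>The genus of a compact surface is half the rank of its first homology group. The
  compactification is sought on the same type; this is no restriction, since a surface is an
  infinite set and so adding finitely many points does not change its cardinality.\<close>

definition compact_genus :: "'a surface \<Rightarrow> nat \<Rightarrow> bool" where
  "compact_genus Y g \<longleftrightarrow> riemann_surface Y \<and> compact_space (topol Y) \<and>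
     homology_group 1 (topol Y) \<cong> free_Abelian_group {..<2 * g}"

definition surface_of_type :: "'a surface \<Rightarrow> nat \<Rightarrow> nat \<Rightarrow> bool" where
  "surface_of_type X g n \<longleftrightarrow> riemann_surface X \<and>
     (\<exists>(Y :: 'a surface) P h. compact_genus Y g \<and> P \<subseteq> points Y \<and> finite P \<and> card P = n \<and>
        conformal_map X (open_subsurface Y (points Y - P)) h)"

text \<open>A coordinate \<open>z\<close> around a puncture: it maps \<open>U\<close> onto the punctured unit disc, and the closedness
  condition says that the missing centre \<open>z = 0\<close> is not a point of \<open>X\<close>.\<close>

definition puncture_chart :: "'a surface \<Rightarrow> 'a chart \<Rightarrow> bool" where
  "puncture_chart X = (\<lambda>(U, z). (U, z) \<in> charts X \<and> z ` U = ball 0 1 - {0} \<and>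
     closedin (topol X) {p \<in> U. cmod (z p) \<le> 1/2})"


section \<open>Quasiconformal mappings and Teichmueller space\<close>

definition abs_continuous_on :: "real \<Rightarrow> real \<Rightarrow> (real \<Rightarrow> complex) \<Rightarrow> bool" where
  "abs_continuous_on a b f \<longleftrightarrow>
     (\<forall>e>0. \<exists>d>0. \<forall>I :: (real \<times> real) set.
        finite I \<and> (\<forall>(s, t)\<in>I. a \<le> s \<and> s \<le> t \<and> t \<le> b) \<and>
        pairwise (\<lambda>i j. {fst i<..<snd i} \<inter> {fst j<..<snd j} = {}) I \<and>
        (\<Sum>(s, t)\<in>I. t - s) < d
        \<longrightarrow> (\<Sum>(s, t)\<in>I. cmod (f t - f s)) < e)"

text \<open>The ACL property: absolute continuity on almost every horizontal and vertical segment of each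
  closed rectangle in \<open>D\<close>.\<close>

definition ACL_on :: "complex set \<Rightarrow> (complex \<Rightarrow> complex) \<Rightarrow> bool" where
  "ACL_on D F \<longleftrightarrow>
     (\<forall>x1 x2 y1 y2. {w. Re w \<in> {x1..x2} \<and> Im w \<in> {y1..y2}} \<subseteq> D \<longrightarrow>
        (AE y in lborel. y \<in> {y1..y2} \<longrightarrow> abs_continuous_on x1 x2 (\<lambda>x. F (Complex x y))) \<and>
        (AE x in lborel. x \<in> {x1..x2} \<longrightarrow> abs_continuous_on y1 y2 (\<lambda>y. F (Complex x y))))"

definition partial_x :: "(complex \<Rightarrow> complex) \<Rightarrow> complex \<Rightarrow> complex" where
  "partial_x F w = vector_derivative (\<lambda>t. F (w + of_real t)) (at 0)"

definition partial_y :: "(complex \<Rightarrow> complex) \<Rightarrow> complex \<Rightarrow> complex" where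
  "partial_y F w = vector_derivative (\<lambda>t. F (w + \<i> * of_real t)) (at 0)"

definition d_z :: "(complex \<Rightarrow> complex) \<Rightarrow> complex \<Rightarrow> complex" where
  "d_z F w = (partial_x F w - \<i> * partial_y F w) / 2"

definition d_zbar :: "(complex \<Rightarrow> complex) \<Rightarrow> complex \<Rightarrow> complex" where
  "d_zbar F w = (partial_x F w + \<i> * partial_y F w) / 2"

text \<open>The analytic definition of quasiconformality, with one dilatation bound \<open>k < 1\<close> for all
  coordinate representations. It includes preservation of orientation. The partial derivatives
  exist almost everywhere by the ACL property.\<close>

definition quasiconformal :: "'a surface \<Rightarrow> 'b surface \<Rightarrow> ('a \<Rightarrow> 'b) \<Rightarrow> bool" where
  "quasiconformal X Y f \<longleftrightarrow> homeomorphic_map (topol X) (topol Y) f \<and>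
     (\<exists>k. 0 \<le> k \<and> k < 1 \<and>
       (\<forall>(U, z)\<in>charts X. \<forall>(V, w)\<in>charts Y.
          let D = z ` {p \<in> U. f p \<in> V}; F = w \<circ> f \<circ> inv_into U z in
          ACL_on D F \<and>
          (AE \<zeta> in lborel. \<zeta> \<in> D \<longrightarrow> cmod (d_zbar F \<zeta>) \<le> k * cmod (d_z F \<zeta>))))"

text \<open>The pairs \<open>(S, f)\<close> representing points of the Teichmueller space of \<open>X\<close>, and the relation
  whose classes are these points. The surfaces may live on different types.\<close>

definition marked_surface :: "'a surface \<Rightarrow> 'b surface \<Rightarrow> ('a \<Rightarrow> 'b) \<Rightarrow> bool" where
  "marked_surface X S f \<longleftrightarrow> riemann_surface S \<and> quasiconformal X S f"

definition teichmueller_equiv ::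
    "'a surface \<Rightarrow> 'b surface \<Rightarrow> ('a \<Rightarrow> 'b) \<Rightarrow> 'c surface \<Rightarrow> ('a \<Rightarrow> 'c) \<Rightarrow> bool" where
  "teichmueller_equiv X S\<^sub>1 f\<^sub>1 S\<^sub>2 f\<^sub>2 \<longleftrightarrow>
     (\<exists>h. conformal_map S\<^sub>1 S\<^sub>2 h \<and>
          homotopic_with (\<lambda>_. True) (topol S\<^sub>1) (topol S\<^sub>2) h (f\<^sub>2 \<circ> inv_into (points X) f\<^sub>1))"


section \<open>Admissible curve families\<close>

text \<open>Closed curves are maps from the unit circle.\<close>

type_synonym 'a loop = "complex \<Rightarrow> 'a"

abbreviation circle :: "complex topology" where
  "circle \<equiv> top_of_set (sphere 0 1)"

definition simple_closed_curve :: "'a surface \<Rightarrow> 'a loop \<Rightarrow> bool" where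
  "simple_closed_curve X c \<longleftrightarrow> continuous_map circle (topol X) c \<and> inj_on c (sphere 0 1)"

text \<open>Homotopy of unoriented closed curves: reversing the orientation is allowed.\<close>

definition curve_homotopic :: "'a surface \<Rightarrow> 'a loop \<Rightarrow> 'a loop \<Rightarrow> bool" where
  "curve_homotopic X c d \<longleftrightarrow>
     homotopic_with (\<lambda>_. True) circle (topol X) c d \<or>
     homotopic_with (\<lambda>_. True) circle (topol X) c (d \<circ> cnj)"

definition trivial_curve :: "'a surface \<Rightarrow> 'a loop \<Rightarrow> bool" where
  "trivial_curve X c \<longleftrightarrow> (\<exists>p. homotopic_with (\<lambda>_. True) circle (topol X) c (\<lambda>_. p))"

definition peripheral_curve :: "'a surface \<Rightarrow> 'a loop \<Rightarrow> bool" where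
  "peripheral_curve X c \<longleftrightarrow>
     (\<exists>U z. puncture_chart X (U, z) \<and> curve_homotopic X c (\<lambda>\<zeta>. inv_into U z (\<zeta> / 2)))"

definition admissible_family :: "'a surface \<Rightarrow> ('k \<Rightarrow> 'a loop) \<Rightarrow> bool" where
  "admissible_family X \<gamma> \<longleftrightarrow>
     (\<forall>j. simple_closed_curve X (\<gamma> j) \<and> \<not> trivial_curve X (\<gamma> j) \<and> \<not> peripheral_curve X (\<gamma> j)) \<and>
     (\<forall>i j. i \<noteq> j \<longrightarrow>
        \<gamma> i ` sphere 0 1 \<inter> \<gamma> j ` sphere 0 1 = {} \<and> \<not> curve_homotopic X (\<gamma> i) (\<gamma> j))"


section \<open>Holomorphic quadratic differentials\<close>

text \<open>\<open>\<phi> (U, z)\<close> is the coefficient of \<open>dz\<^sup>2\<close> as a function of the coordinate \<open>z\<close>. It is set to \<open>0\<close>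
  off \<open>z ` U\<close> so that equality of differentials is equality of functions.\<close>

type_synonym 'a qdiff = "'a chart \<Rightarrow> complex \<Rightarrow> complex"

definition zero_qdiff :: "'a qdiff" where
  "zero_qdiff = (\<lambda>_ _. 0)"

text \<open>The integral of the density \<open>|\<phi>(z)| dx dy\<close> over \<open>X\<close>: the supremum, over finite families of
  pairwise disjoint Borel sets each lying in a chart domain, of the sum of the integrals over these
  sets, computed in the charts.\<close>

definition qnorm :: "'a surface \<Rightarrow> 'a qdiff \<Rightarrow> ennreal" where
  "qnorm X \<phi> = Sup {\<Sum>((U, z), E)\<in>\<D>. \<integral>\<^sup>+ w\<in>z ` E. ennreal (cmod (\<phi> (U, z) w)) \<partial>lborel | \<D>.
     finite \<D> \<and>
     (\<forall>((U, z), E)\<in>\<D>. (U, z) \<in> charts X \<and> E \<subseteq> U \<and> z ` E \<in> sets borel) \<and>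
     pairwise (\<lambda>x y. snd x \<inter> snd y = {}) \<D>}"

definition quadratic_differential :: "'a surface \<Rightarrow> 'a qdiff \<Rightarrow> bool" where
  "quadratic_differential X \<phi> \<longleftrightarrow>
     (\<forall>c w. \<not> (c \<in> charts X \<and> w \<in> snd c ` fst c) \<longrightarrow> \<phi> c w = 0) \<and>
     (\<forall>(U, z)\<in>charts X. \<phi> (U, z) holomorphic_on z ` U) \<and>
     (\<forall>c\<in>charts X. \<forall>d\<in>charts X. \<forall>w \<in> snd c ` (fst c \<inter> fst d).
        \<phi> c w = \<phi> d (transition c d w) * (deriv (transition c d) w)\<^sup>2) \<and>
     qnorm X \<phi> < \<infinity>"

definition qzeros :: "'a surface \<Rightarrow> 'a qdiff \<Rightarrow> 'a set" where
  "qzeros X \<phi> = {p. \<exists>(U, z)\<in>charts X. p \<in> U \<and> \<phi> (U, z) (z p) = 0}"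

text \<open>An analytic curve with \<open>\<phi>(\<gamma>(t)) \<gamma>'(t)\<^sup>2 < 0\<close>; in a coordinate it is locally the restriction to
  the reals of a holomorphic function \<open>G\<close>. The condition does not depend on the parametrization, so
  the parameter interval may be taken to be the whole real line.\<close>

definition vertical_curve :: "'a surface \<Rightarrow> 'a qdiff \<Rightarrow> (real \<Rightarrow> 'a) \<Rightarrow> bool" where
  "vertical_curve X \<phi> \<gamma> \<longleftrightarrow> range \<gamma> \<subseteq> points X \<and>
     (\<forall>t. \<forall>(U, z)\<in>charts X. \<gamma> t \<in> U \<longrightarrow>
        (\<exists>G. G analytic_on {complex_of_real t} \<and>
             (\<forall>\<^sub>F s in nhds t. \<gamma> s \<in> U \<and> z (\<gamma> s) = G (complex_of_real s)) \<and>
             (let q = \<phi> (U, z) (z (\<gamma> t)) * (deriv G (complex_of_real t))\<^sup>2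
              in Im q = 0 \<and> Re q < 0)))"

text \<open>Trajectories are treated as point sets, and maximality is maximality of the point set.\<close>

definition vertical_trajectory :: "'a surface \<Rightarrow> 'a qdiff \<Rightarrow> 'a set \<Rightarrow> bool" where
  "vertical_trajectory X \<phi> T \<longleftrightarrow>
     (\<exists>\<gamma>. vertical_curve X \<phi> \<gamma> \<and> T = range \<gamma>) \<and>
     (\<forall>\<gamma>. vertical_curve X \<phi> \<gamma> \<and> T \<subseteq> range \<gamma> \<longrightarrow> range \<gamma> = T)"

definition closed_vertical_trajectory :: "'a surface \<Rightarrow> 'a qdiff \<Rightarrow> 'a set \<Rightarrow> bool" where
  "closed_vertical_trajectory X \<phi> T \<longleftrightarrow> vertical_trajectory X \<phi> T \<and>
     (\<exists>\<gamma>. \<exists>\<tau>>0. vertical_curve X \<phi> \<gamma> \<and> T = range \<gamma> \<and> (\<forall>t. \<gamma> (t + \<tau>) = \<gamma> t))"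

text \<open>The critical points are the zeros in \<open>X\<close> and the punctures, where simple poles may occur. A
  puncture across which \<open>\<phi>\<close> extends with a non-zero value has to be included: on a once-punctured
  torus every non-zero \<open>\<phi>\<close> is of this kind, and with an empty critical graph there would be no
  Jenkins-Strebel differential, contrary to Strebel's existence theorem.\<close>

definition tends_to_critical :: "'a surface \<Rightarrow> 'a qdiff \<Rightarrow> (real \<Rightarrow> 'a) \<Rightarrow> real filter \<Rightarrow> bool" where
  "tends_to_critical X \<phi> \<gamma> \<F> \<longleftrightarrow>
     (\<exists>p\<in>qzeros X \<phi>. limitin (topol X) \<gamma> p \<F>) \<or>
     (\<exists>U z. puncture_chart X (U, z) \<and> (\<forall>\<^sub>F t in \<F>. \<gamma> t \<in> U) \<and> ((\<lambda>t. z (\<gamma> t)) \<longlongrightarrow> 0) \<F>)"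

definition critical_graph :: "'a surface \<Rightarrow> 'a qdiff \<Rightarrow> 'a set" where
  "critical_graph X \<phi> = qzeros X \<phi> \<union>
     \<Union>{T. vertical_trajectory X \<phi> T \<and>
          (\<exists>\<gamma>. vertical_curve X \<phi> \<gamma> \<and> T = range \<gamma> \<and>
               tends_to_critical X \<phi> \<gamma> at_bot \<and> tends_to_critical X \<phi> \<gamma> at_top)}"


section \<open>Ring domains\<close>

text \<open>A conformal equivalence of the Euclidean cylinder of height \<open>h\<close> and circumference \<open>l\<close> with \<open>R\<close>,
  written as an \<open>l\<close>-periodic holomorphic map \<open>u\<close> on the strip \<open>0 < Im s < h\<close>. (Doubly connected
  domains of infinite modulus need not be considered: their core curves are trivial or peripheral,
  and they have infinite area in the metric of a differential sweeping them out.)\<close>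

definition strip :: "real \<Rightarrow> complex set" where
  "strip h = {s. 0 < Im s \<and> Im s < h}"

definition cylinder_map :: "'a surface \<Rightarrow> 'a set \<Rightarrow> real \<Rightarrow> real \<Rightarrow> (complex \<Rightarrow> 'a) \<Rightarrow> bool" where
  "cylinder_map X R h l u \<longleftrightarrow> 0 < h \<and> 0 < l \<and>
     continuous_map (top_of_set (strip h)) (topol X) u \<and> u ` strip h = R \<and>
     (\<forall>(U, z)\<in>charts X. (z \<circ> u) holomorphic_on {s \<in> strip h. u s \<in> U}) \<and>
     (\<forall>s\<in>strip h. \<forall>s'\<in>strip h. u s = u s' \<longleftrightarrow> (\<exists>m::int. s' = s + of_int m * of_real l))"

definition ring_domain :: "'a surface \<Rightarrow> 'a set \<Rightarrow> bool" where
  "ring_domain X R \<longleftrightarrow> (\<exists>h l u. cylinder_map X R h l u)"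

definition modulus :: "'a surface \<Rightarrow> 'a set \<Rightarrow> real" where
  "modulus X R = (if R = {} then 0 else (THE M. \<exists>h l u. cylinder_map X R h l u \<and> M = h / l))"

definition core_curve :: "real \<Rightarrow> real \<Rightarrow> (complex \<Rightarrow> 'a) \<Rightarrow> 'a loop" where
  "core_curve h l u = (\<lambda>\<zeta>. u (Complex (l * Arg \<zeta> / (2 * pi)) (h / 2)))"

definition ring_of_type :: "'a surface \<Rightarrow> 'a set \<Rightarrow> 'a loop \<Rightarrow> bool" where
  "ring_of_type X R c \<longleftrightarrow>
     (\<exists>h l u. cylinder_map X R h l u \<and> curve_homotopic X (core_curve h l u) c)"

text \<open>The index set \<open>J\<close> singles out the subfamily of curves \<open>\<gamma> j\<close> with \<open>j \<in> J\<close>.\<close>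

definition family_of_type :: "'a surface \<Rightarrow> 'k set \<Rightarrow> ('k \<Rightarrow> 'a loop) \<Rightarrow> ('k \<Rightarrow> 'a set) \<Rightarrow> bool" where
  "family_of_type X J \<gamma> R \<longleftrightarrow> (\<forall>j\<in>J. R j = {} \<or> ring_of_type X (R j) (\<gamma> j))"

definition non_overlapping :: "'k set \<Rightarrow> ('k \<Rightarrow> 'a set) \<Rightarrow> bool" where
  "non_overlapping J R \<longleftrightarrow> (\<forall>i\<in>J. \<forall>j\<in>J. i \<noteq> j \<longrightarrow> R i \<inter> R j = {})"


section \<open>Jenkins-Strebel differentials\<close>

definition characteristic_domains :: "'a surface \<Rightarrow> 'a qdiff \<Rightarrow> 'a set set" where
  "characteristic_domains X \<phi> =
     connected_components_of (subtopology (topol X) (points X - critical_graph X \<phi>))"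

definition jenkins_strebel :: "'a surface \<Rightarrow> 'a qdiff \<Rightarrow> bool" where
  "jenkins_strebel X \<phi> \<longleftrightarrow> quadratic_differential X \<phi> \<and> \<phi> \<noteq> zero_qdiff \<and>
     (\<forall>R\<in>characteristic_domains X \<phi>. ring_domain X R \<and>
        (\<forall>p\<in>R. \<exists>T. closed_vertical_trajectory X \<phi> T \<and> p \<in> T \<and> T \<subseteq> R))"

text \<open>\<open>R\<close> lists the characteristic ring domains of \<open>\<phi>\<close>, each once, with empty sets added, as a
  family of the type of the subfamily \<open>J\<close> of \<open>\<gamma>\<close>.\<close>

definition characteristic_family ::
    "'a surface \<Rightarrow> 'k set \<Rightarrow> ('k \<Rightarrow> 'a loop) \<Rightarrow> 'a qdiff \<Rightarrow> ('k \<Rightarrow> 'a set) \<Rightarrow> bool" where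
  "characteristic_family X J \<gamma> \<phi> R \<longleftrightarrow>
     family_of_type X J \<gamma> R \<and> non_overlapping J R \<and>
     {R j | j. j \<in> J \<and> R j \<noteq> {}} = characteristic_domains X \<phi>"

definition JS_of_type :: "'a surface \<Rightarrow> 'k set \<Rightarrow> ('k \<Rightarrow> 'a loop) \<Rightarrow> 'a qdiff \<Rightarrow> bool" where
  "JS_of_type X J \<gamma> \<phi> \<longleftrightarrow> jenkins_strebel X \<phi> \<and> (\<exists>R. characteristic_family X J \<gamma> \<phi> R)"

definition JS :: "'a surface \<Rightarrow> ('k \<Rightarrow> 'a loop) \<Rightarrow> 'a qdiff set" where
  "JS X \<gamma> = {\<phi>. JS_of_type X UNIV \<gamma> \<phi>} \<union> {zero_qdiff}"

definition JS0 :: "'a surface \<Rightarrow> ('k \<Rightarrow> 'a loop) \<Rightarrow> 'a qdiff set" where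
  "JS0 X \<gamma> = {\<phi> \<in> JS X \<gamma>. qnorm X \<phi> = 1}"

text \<open>The curves along which \<open>|\<phi>|\<^sup>1\<^sup>/\<^sup>2\<close> can be integrated are the rectifiable ones, and these are
  taken with an absolutely continuous parametrization \<open>t \<mapsto> c (cis t)\<close>. The integrand
  \<open>|\<phi>(z)|\<^sup>1\<^sup>/\<^sup>2 |dz/dt|\<close> is then defined for almost all \<open>t\<close>, and does not depend on the chart.\<close>

definition rectifiable_curve :: "'a surface \<Rightarrow> 'a loop \<Rightarrow> bool" where
  "rectifiable_curve X c \<longleftrightarrow>
     (\<forall>(U, z)\<in>charts X. \<forall>a b. a \<le> b \<and> (\<lambda>t. c (cis t)) ` {a..b} \<subseteq> U \<longrightarrow>
        abs_continuous_on a b (\<lambda>t. z (c (cis t))))"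

definition qspeed :: "'a surface \<Rightarrow> 'a qdiff \<Rightarrow> 'a loop \<Rightarrow> real \<Rightarrow> real" where
  "qspeed X \<phi> c t = (THE s. \<forall>(U, z)\<in>charts X. c (cis t) \<in> U \<longrightarrow>
     s = sqrt (cmod (\<phi> (U, z) (z (c (cis t))))) *
         cmod (vector_derivative (\<lambda>t. z (c (cis t))) (at t)))"

definition qlength :: "'a surface \<Rightarrow> 'a qdiff \<Rightarrow> 'a loop \<Rightarrow> ennreal" where
  "qlength X \<phi> c = (\<integral>\<^sup>+ t\<in>{0..2 * pi}. ennreal (qspeed X \<phi> c t) \<partial>lborel)"

definition inf_length :: "'a surface \<Rightarrow> 'a qdiff \<Rightarrow> 'a loop \<Rightarrow> ennreal" where
  "inf_length X \<phi> c = Inf {qlength X \<phi> c' | c'.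
     simple_closed_curve X c' \<and> curve_homotopic X c' c \<and> rectifiable_curve X c'}"


section \<open>The surface of circumferences\<close>

text \<open>The characterization of the differential that belongs to positive weights \<open>A j\<close>, \<open>j \<in> J\<close>.\<close>

definition extremal_JS ::
    "'a surface \<Rightarrow> 'k set \<Rightarrow> ('k \<Rightarrow> 'a loop) \<Rightarrow> ('k \<Rightarrow> real) \<Rightarrow> 'a qdiff \<Rightarrow> bool" where
  "extremal_JS X J \<gamma> A \<phi> \<longleftrightarrow> jenkins_strebel X \<phi> \<and>
     (\<exists>R. characteristic_family X J \<gamma> \<phi> R \<and>
        (\<forall>R'. family_of_type X J \<gamma> R' \<and> non_overlapping J R' \<longrightarrow>
           (\<Sum>j\<in>J. (A j)\<^sup>2 * modulus X (R' j)) \<le> (\<Sum>j\<in>J. (A j)\<^sup>2 * modulus X (R j))) \<and>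
        (\<forall>j\<in>J. (modulus X (R j) > 0 \<longrightarrow> ennreal (A j) = inf_length X \<phi> (\<gamma> j)) \<and>
                (modulus X (R j) = 0 \<longrightarrow> ennreal (A j) \<le> inf_length X \<phi> (\<gamma> j))))"

text \<open>The curves with weight \<open>0\<close> are omitted. By Strebel's theorem the unique existence always holds
  for admissible families and \<open>J \<noteq> {}\<close>; it is tested only to make the function total without
  resorting to that theorem, and the value \<open>0\<close> in the void case never has norm \<open>1\<close>.\<close>

definition F_map :: "'a surface \<Rightarrow> ('k \<Rightarrow> 'a loop) \<Rightarrow> real ^ 'k \<Rightarrow> 'a qdiff" where
  "F_map X \<gamma> A =
     (let J = {j. A $ j > 0} in
      if J \<noteq> {} \<and> (\<exists>!\<phi>. extremal_JS X J \<gamma> (($) A) \<phi>)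
      then (THE \<phi>. extremal_JS X J \<gamma> (($) A) \<phi>)
      else zero_qdiff)"

definition circumference_surface :: "'a surface \<Rightarrow> ('k::finite \<Rightarrow> 'a loop) \<Rightarrow> (real ^ 'k) set" where
  "circumference_surface X \<gamma> =
     {(\<chi> j. (A $ j)\<^sup>2) | A. (\<forall>j. 0 \<le> A $ j) \<and> F_map X \<gamma> A \<in> JS0 X \<gamma>}"

end

(* A marking-preserving conformal map h identifies the two maximal atlases: composing charts with h
   and with its inverse maps each atlas into the other. Quadratic differentials therefore correspond
   bijectively, with the same coefficients in corresponding charts, and the correspondence preserves
   norms, trajectories, critical graphs, ring domains, moduli and lengths of curves. The curve family
   enters the definition of the circumference surface only through homotopy classes, and h maps the
   class of f1(gamma_j) to that of f2(gamma_j). *)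

theory Submission
  imports Defs
begin

section \<open>Isomorphic surfaces\<close>

text \<open>The set-up is symmetric under exchanging \<open>X\<close>, \<open>h\<close> with
  \<open>Y\<close>, \<open>h'\<close>, so each invariance is proved as a one-sided implication,
  inclusion or inequality, and the converse is the same statement for the exchanged data. Two things
  shape the details. Coordinates and curves are total functions with arbitrary values off their
  domains, and \<open>h'\<close> inverts \<open>h\<close> only on the surface. Pushing a chart
  forward and pulling it back may therefore give a different member of the atlas, and the
  correspondence of differentials is formulated as the relation \<open>qdiff_iso\<close> instead of
  a pair of inverse maps. Moreover, \<open>F_map\<close> selects its value only after a test of
  unique existence, so unique existence itself has to be carried from one surface to the other; this
  works because related differentials determine each other.\<close>

locale surface_iso =
  fixes X :: "'b surface" and Y :: "'c surface" and h :: "'b \<Rightarrow> 'c" and h' :: "'c \<Rightarrow> 'b"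
  assumes riemann_X: "riemann_surface X" and riemann_Y: "riemann_surface Y"
    and homeo: "homeomorphic_maps (topol X) (topol Y) h h'"
    and push_chart: "(U, z) \<in> charts X \<Longrightarrow> (h ` U, z \<circ> h') \<in> charts Y"
    and pull_chart: "(V, w) \<in> charts Y \<Longrightarrow> (h' ` V, w \<circ> h) \<in> charts X"

section \<open>Charts and conformal maps\<close>

lemma chart_subset: "riemann_surface X \<Longrightarrow> (U, z) \<in> charts X \<Longrightarrow> U \<subseteq> points X"
  unfolding riemann_surface_def is_chart_def by (fastforce dest: openin_subset)

lemma is_chart_inj: "is_chart T (U, z) \<Longrightarrow> inj_on z U"
  unfolding is_chart_def using homeomorphic_imp_injective_map[of "subtopology T U"] openin_subset[of T U]
  by (auto simp: Int_absorb1)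

lemma chart_inj: "riemann_surface X \<Longrightarrow> (U, z) \<in> charts X \<Longrightarrow> inj_on z U"
  unfolding riemann_surface_def by (blast intro: is_chart_inj)

text \<open>Relative openness in the image of the chart is openness in the plane, because that image
  is itself open. This supplies the open domain on which an injective holomorphic function can be
  inverted.\<close>

lemma chart_open_image:
  assumes "is_chart T (U, z)" "openin T W" "W \<subseteq> U"
  shows "open (z ` W)"
proof -
  have "openin (subtopology T U) W"
    using assms by (simp add: openin_open_subtopology is_chart_def)
  moreover have "homeomorphic_map (subtopology T U) (top_of_set (z ` U)) z" and o: "open (z ` U)"
    using assms(1) unfolding is_chart_def by auto
  ultimately have "openin (top_of_set (z ` U)) (z ` W)"
    using homeomorphic_map_openness_eq by blast
  then show ?thesis
    using o openin_open_trans by blast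
qed

lemma is_chart_compose:
  assumes g: "homeomorphic_map T T' g" and c: "is_chart T' (V, w)"
    and U: "openin T U" "g ` U = V"
  shows "is_chart T (U, w \<circ> g)"
proof -
  have oV: "openin T' V" and V: "open (w ` V)"
    and w: "homeomorphic_map (subtopology T' V) (top_of_set (w ` V)) w"
    using c unfolding is_chart_def by auto
  have "g ` (topspace T \<inter> U) = topspace T' \<inter> V"
    using U openin_subset[OF U(1)] openin_subset[OF oV] by (simp add: Int_absorb1)
  then have "homeomorphic_map (subtopology T U) (subtopology T' V) g"
    by (rule homeomorphic_map_subtopologies[OF g])
  then have "homeomorphic_map (subtopology T U) (top_of_set (w ` V)) (w \<circ> g)"
    using w by (rule homeomorphic_map_compose)
  moreover have "(w \<circ> g) ` U = w ` V" using U(2) by (metis image_comp)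
  ultimately show ?thesis
    using U(1) V unfolding is_chart_def by simp
qed

text \<open>Holomorphy of the inverse, not demanded in the definition of a conformal map, comes from
  injectivity.\<close>

lemma conformal_map_pull_chart:
  assumes X: "riemann_surface X" and Y: "riemann_surface Y" and conf: "conformal_map X Y h"
    and hom: "homeomorphic_maps (topol X) (topol Y) h h'" and c: "(V, w) \<in> charts Y"
  shows "(h' ` V, w \<circ> h) \<in> charts X"
proof -
  let ?U = "h' ` V"
  have isc: "is_chart (topol Y) (V, w)"
    using Y c unfolding riemann_surface_def by blast
  have oV: "openin (topol Y) V" using isc unfolding is_chart_def by blast
  have subV: "V \<subseteq> points Y" using oV by (rule openin_subset)
  have hmap: "homeomorphic_map (topol X) (topol Y) h" and h'map: "homeomorphic_map (topol Y) (topol X) h'"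
    using hom homeomorphic_maps_map by blast+
  have hh': "h (h' q) = q" "h' q \<in> points X" if "q \<in> points Y" for q
    using hom that homeomorphic_imp_surjective_map[OF h'map] unfolding homeomorphic_maps_def by auto
  have h'h: "h' (h p) = p" if "p \<in> points X" for p
    using hom that unfolding homeomorphic_maps_def by auto
  have oU: "openin (topol X) ?U"
    using h'map homeomorphic_map_openness[OF h'map subV] oV by simp
  have img: "h ` ?U = V" using hh' subV by (force simp: image_iff)
  have injw: "inj_on w V" using chart_inj[OF Y c] .
  have isp: "is_chart (topol X) (?U, w \<circ> h)"
    using is_chart_compose[OF hmap isc oU img] .
  have "compatible (?U, w \<circ> h) d" if d: "d \<in> charts X" for d
  proof (cases d)
    case (Pair W z)
    have d': "(W, z) \<in> charts X" using d Pair by simp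
    have isd: "is_chart (topol X) (W, z)" using X d' unfolding riemann_surface_def by blast
    have injz: "inj_on z W" using chart_inj[OF X d'] .
    have subW: "W \<subseteq> points X" using chart_subset[OF X d'] .
    have oW: "openin (topol X) W" using isd unfolding is_chart_def by blast
    let ?D = "?U \<inter> W"
    have "p \<in> ?U \<longleftrightarrow> h p \<in> V" if "p \<in> W" for p
      using that subW h'h hh' subV by (metis image_iff subsetD)
    then have eq: "{p \<in> W. h p \<in> V} = ?D" by blast
    have oD: "openin (topol X) ?D" using oU oW by blast
    have hol: "(w \<circ> h \<circ> inv_into W z) holomorphic_on z ` ?D"
      using conf d' c eq unfolding conformal_map_def by fastforce
    have injwh: "inj_on (w \<circ> h) ?U" using is_chart_inj[OF isp] .
    have inv_z: "inv_into W z (z p) = p" if "p \<in> W" for p using injz that by simp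
    have inv_wh: "inv_into ?U (w \<circ> h) (w (h p)) = p" if "p \<in> ?U" for p
      using inv_into_f_f[OF injwh that] by simp
    have inj1: "inj_on (w \<circ> h \<circ> inv_into W z) (z ` ?D)"
    proof (rule inj_onI)
      fix x y assume xy: "x \<in> z ` ?D" "y \<in> z ` ?D"
        "(w \<circ> h \<circ> inv_into W z) x = (w \<circ> h \<circ> inv_into W z) y"
      then obtain p q where pq: "p \<in> ?D" "q \<in> ?D" "x = z p" "y = z q" by blast
      then have "(w \<circ> h) p = (w \<circ> h) q" using xy(3) by (simp add: inv_z)
      then have "p = q" using inj_onD[OF injwh] pq(1,2) by blast
      then show "x = y" using pq by simp
    qed
    have im1: "(w \<circ> h \<circ> inv_into W z) ` z ` ?D = (w \<circ> h) ` ?D"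
      using inv_z by (force simp: image_iff)
    \<comment> \<open>\<open>G\<close> is the opposite coordinate change on the image of the
      overlap; \<open>Gx\<close> and \<open>inv_wh\<close> identify the two pointwise.\<close>
    obtain G where G: "G holomorphic_on (w \<circ> h \<circ> inv_into W z) ` z ` ?D"
      "\<And>x. x \<in> z ` ?D \<Longrightarrow> G ((w \<circ> h \<circ> inv_into W z) x) = x"
      by (rule holomorphic_has_inverse[OF hol chart_open_image[OF isd oD] inj1]) blast+
    have Gx: "G (w (h p)) = z p" if "p \<in> ?D" for p
      using G(2)[of "z p"] that inv_z by simp
    have "(z \<circ> inv_into ?U (w \<circ> h)) holomorphic_on (w \<circ> h) ` ?D"
      using G(1)[unfolded im1]
      by (rule holomorphic_transform) (use Gx inv_wh in auto)
    then show ?thesis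
      using hol unfolding compatible_def transition_def Pair by (simp add: Int_commute)
  qed
  \<comment> \<open>Maximality of the atlas: a chart compatible with all its members belongs to
    it.\<close>
  then show ?thesis
    using X isp unfolding riemann_surface_def by blast
qed

text \<open>Once the pulled back chart \<open>w \<circ> h\<close> is known to lie in the atlas of
  \<open>X\<close>, the coordinate expression of \<open>h'\<close> is a coordinate change of
  \<open>X\<close>, hence holomorphic.\<close>

lemma conformal_map_inverse:
  assumes X: "riemann_surface X" and Y: "riemann_surface Y" and conf: "conformal_map X Y h"
    and hom: "homeomorphic_maps (topol X) (topol Y) h h'"
  shows "conformal_map Y X h'"
  unfolding conformal_map_def
proof (intro conjI ballI, safe)
  show "homeomorphic_map (topol Y) (topol X) h'"
    using hom homeomorphic_maps_map by blast
  fix V w U z assume c: "(V, w) \<in> charts Y" and d: "(U, z) \<in> charts X"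
  have p: "(h' ` V, w \<circ> h) \<in> charts X" using conformal_map_pull_chart[OF X Y conf hom c] .
  have subV: "V \<subseteq> points Y" using chart_subset[OF Y c] .
  have hh': "h (h' q) = q" if "q \<in> points Y" for q
    using hom that unfolding homeomorphic_maps_def by auto
  have "compatible (h' ` V, w \<circ> h) (U, z)" using X p d unfolding riemann_surface_def by blast
  then have hol: "(z \<circ> inv_into (h' ` V) (w \<circ> h)) holomorphic_on (w \<circ> h) ` (h' ` V \<inter> U)"
    unfolding compatible_def transition_def by simp
  have eq: "(w \<circ> h) ` (h' ` V \<inter> U) = w ` {q \<in> V. h' q \<in> U}"
    using hh' subV by (force simp: image_iff)
  show "(z \<circ> h' \<circ> inv_into V w) holomorphic_on w ` {p \<in> V. h' p \<in> U}"
    using hol[unfolded eq]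
  proof (rule holomorphic_transform)
    fix x assume "x \<in> w ` {q \<in> V. h' q \<in> U}"
    then obtain q where q: "q \<in> V" "x = w q" by blast
    have "inv_into (h' ` V) (w \<circ> h) x = h' q"
      using inv_into_f_f[OF chart_inj[OF X p], of "h' q"] q hh' subV by (auto simp: subset_iff)
    moreover have "inv_into V w x = q" using chart_inj[OF Y c] q by simp
    ultimately show "(z \<circ> inv_into (h' ` V) (w \<circ> h)) x = (z \<circ> h' \<circ> inv_into V w) x" by simp
  qed
qed

text \<open>Pushing charts along \<open>h\<close> is pulling them back along \<open>h'\<close>, so
  one pullback lemma, applied to \<open>h\<close> and to its conformal inverse, gives both
  assumptions on the atlases.\<close>

lemma conformal_map_imp_surface_iso:
  assumes X: "riemann_surface X" and Y: "riemann_surface Y" and conf: "conformal_map X Y h"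
  obtains h' where "surface_iso X Y h h'"
proof -
  obtain h' where hom: "homeomorphic_maps (topol X) (topol Y) h h'"
    using conf homeomorphic_map_maps unfolding conformal_map_def by blast
  have hom': "homeomorphic_maps (topol Y) (topol X) h' h"
    using hom homeomorphic_maps_sym by blast
  have "surface_iso X Y h h'"
    using conformal_map_pull_chart[OF X Y conf hom]
      conformal_map_pull_chart[OF Y X conformal_map_inverse[OF X Y conf hom] hom']
    by (unfold_locales) (auto intro: X Y hom)
  then show ?thesis by (rule that)
qed

section \<open>Topology, curves and ring domains under an isomorphism\<close>

context surface_iso
begin

lemma swap: "surface_iso Y X h' h"
  using riemann_X riemann_Y homeo homeomorphic_maps_sym push_chart pull_chart
  unfolding surface_iso_def by blast

lemma cont: "continuous_map (topol X) (topol Y) h"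
  using homeo unfolding homeomorphic_maps_def by blast

lemma cont': "continuous_map (topol Y) (topol X) h'"
  using homeo unfolding homeomorphic_maps_def by blast

lemma in_Y: "p \<in> points X \<Longrightarrow> h p \<in> points Y"
  using cont by (auto simp: continuous_map_def)

lemma in_X: "q \<in> points Y \<Longrightarrow> h' q \<in> points X"
  using cont' by (auto simp: continuous_map_def)

lemma h'h: "p \<in> points X \<Longrightarrow> h' (h p) = p"
  using homeo unfolding homeomorphic_maps_def by blast

lemma hh': "q \<in> points Y \<Longrightarrow> h (h' q) = q"
  using homeo unfolding homeomorphic_maps_def by blast

lemma inj_h: "inj_on h (points X)"
  by (metis h'h inj_onI)

lemma h'_image_h: "A \<subseteq> points X \<Longrightarrow> h' ` h ` A = A"
  using h'h by (force simp: image_iff)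

lemma h_image_h': "B \<subseteq> points Y \<Longrightarrow> h ` h' ` B = B"
  using hh' by (force simp: image_iff)

lemma h_image_Int: "A \<subseteq> points X \<Longrightarrow> B \<subseteq> points X \<Longrightarrow> h ` (A \<inter> B) = h ` A \<inter> h ` B"
  using inj_h by (metis inj_on_image_Int)

lemma image_points: "h ` points X = points Y"
  using in_Y in_X hh' by (force simp: image_iff)

lemma homeomorphic: "homeomorphic_map (topol X) (topol Y) h"
  using homeo homeomorphic_maps_map by blast

lemma chart_X: "(U, z) \<in> charts X \<Longrightarrow> U \<subseteq> points X"
  using chart_subset[OF riemann_X] .

lemma chart_Y: "(V, w) \<in> charts Y \<Longrightarrow> V \<subseteq> points Y"
  using chart_subset[OF riemann_Y] .

lemma mem_pull: "(V, w) \<in> charts Y \<Longrightarrow> p \<in> points X \<Longrightarrow> p \<in> h' ` V \<longleftrightarrow> h p \<in> V"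
  using chart_Y h'h hh' by (force simp: image_iff)

lemma pull_image: "(V, w) \<in> charts Y \<Longrightarrow> (w \<circ> h) ` h' ` V = w ` V"
  using h_image_h'[OF chart_Y] by (metis image_comp)

lemma push_pull_image: "(U, z) \<in> charts X \<Longrightarrow> E \<subseteq> U \<Longrightarrow> (z \<circ> h') ` h ` E = z ` E"
  using h'_image_h chart_X by (metis image_comp subset_trans)

text \<open>The inverse of \<open>w \<circ> h\<close> ends with \<open>h'\<close>, which cancels
  against the \<open>h\<close> of the second chart. Equality holds on the whole coordinate image of
  \<open>V\<close>, an open set, so that the derivatives in the transformation rule can be compared
  as well.\<close>

lemma transition_pull:
  assumes c: "(V, w) \<in> charts Y" and d: "(V2, w2) \<in> charts Y" and x: "x \<in> w ` V"
  shows "transition (h' ` V, w \<circ> h) (h' ` V2, w2 \<circ> h) x = transition (V, w) (V2, w2) x"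
proof -
  obtain q where q: "q \<in> V" "x = w q" using x by blast
  have q': "h (h' q) = q" using hh' chart_Y[OF c] q by blast
  have "inv_into (h' ` V) (w \<circ> h) x = h' q"
    using inv_into_f_f[OF chart_inj[OF riemann_X pull_chart[OF c]], of "h' q"] q q' by auto
  moreover have "inv_into V w x = q" using chart_inj[OF riemann_Y c] q by simp
  ultimately show ?thesis using q' by (simp add: transition_def)
qed

lemma puncture_chart_push:
  assumes "puncture_chart X (U, z)"
  shows "puncture_chart Y (h ` U, z \<circ> h')"
proof -
  have c: "(U, z) \<in> charts X" and im: "z ` U = ball 0 1 - {0}"
    and cl: "closedin (topol X) {p \<in> U. cmod (z p) \<le> 1/2}"
    using assms unfolding puncture_chart_def by auto
  have "{q \<in> h ` U. cmod ((z \<circ> h') q) \<le> 1/2} = h ` {p \<in> U. cmod (z p) \<le> 1/2}"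
    using h'h chart_X[OF c] by (force simp: image_iff)
  moreover have "closedin (topol Y) (h ` {p \<in> U. cmod (z p) \<le> 1/2})"
    using cl homeomorphic_map_closedness_eq[OF homeomorphic] by blast
  ultimately show ?thesis
    using push_chart[OF c] push_pull_image[OF c] im unfolding puncture_chart_def by auto
qed

lemma homotopic_push:
  "homotopic_with (\<lambda>_. True) circle (topol X) c d \<Longrightarrow>
   homotopic_with (\<lambda>_. True) circle (topol Y) (h \<circ> c) (h \<circ> d)"
  by (rule homotopic_with_compose_continuous_map_left[OF _ cont]) auto

lemma curve_homotopic_push:
  "curve_homotopic X c d \<Longrightarrow> curve_homotopic Y (h \<circ> c) (h \<circ> d)"
  unfolding curve_homotopic_def using homotopic_push by (metis comp_assoc)

text \<open>Holomorphy of \<open>h \<circ> u\<close> in a chart of \<open>Y\<close> is holomorphy of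
  \<open>u\<close> in the pulled back chart, and injectivity of \<open>h\<close> preserves the
  identifications. Height and circumference stay the same, which is what the modulus needs.\<close>

lemma cylinder_map_push:
  assumes "cylinder_map X R a l u"
  shows "cylinder_map Y (h ` R) a l (h \<circ> u)"
proof -
  have al: "0 < a" "0 < l" and cu: "continuous_map (top_of_set (strip a)) (topol X) u"
    and im: "u ` strip a = R"
    and hol: "\<And>U z. (U, z) \<in> charts X \<Longrightarrow> (z \<circ> u) holomorphic_on {s \<in> strip a. u s \<in> U}"
    and per: "\<forall>s\<in>strip a. \<forall>s'\<in>strip a. u s = u s' \<longleftrightarrow> (\<exists>m::int. s' = s + of_int m * of_real l)"
    using assms unfolding cylinder_map_def by auto
  have pts: "u s \<in> points X" if "s \<in> strip a" for s
    using cu that by (auto simp: continuous_map_def)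
  have "(w \<circ> (h \<circ> u)) holomorphic_on {s \<in> strip a. (h \<circ> u) s \<in> V}" if c: "(V, w) \<in> charts Y" for V w
  proof -
    have "{s \<in> strip a. (h \<circ> u) s \<in> V} = {s \<in> strip a. u s \<in> h' ` V}"
      using mem_pull[OF c] pts by auto
    then show ?thesis using hol[OF pull_chart[OF c]] by (simp add: comp_assoc)
  qed
  moreover have "(h \<circ> u) s = (h \<circ> u) s' \<longleftrightarrow> u s = u s'" if "s \<in> strip a" "s' \<in> strip a" for s s'
    using inj_h pts that by (auto dest: inj_onD)
  ultimately show ?thesis
    using al im per continuous_map_compose[OF cu cont]
    unfolding cylinder_map_def by (auto simp: image_comp[symmetric])
qed

lemma ring_domain_push: "ring_domain X R \<Longrightarrow> ring_domain Y (h ` R)"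
  unfolding ring_domain_def using cylinder_map_push by blast

lemma cylinder_map_subset: "cylinder_map X R a l u \<Longrightarrow> R \<subseteq> points X"
  unfolding cylinder_map_def continuous_map_def by auto

text \<open>Both sides are definite descriptions, and their describing predicates are equivalent:
  cylinder maps correspond with the same two parameters. The hypothesis ensures that
  \<open>h'\<close> carries the image of \<open>R\<close> back to \<open>R\<close>.\<close>

lemma modulus_push:
  assumes "R \<subseteq> points X"
  shows "modulus Y (h ` R) = modulus X R"
proof -
  have "(\<exists>a l u. cylinder_map Y (h ` R) a l u \<and> M = a / l) \<longleftrightarrow>
        (\<exists>a l u. cylinder_map X R a l u \<and> M = a / l)" for M
    using cylinder_map_push surface_iso.cylinder_map_push[OF swap, of "h ` R"] h'_image_h[OF assms]
    by metis
  then show ?thesis unfolding modulus_def by simp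
qed

lemma ring_of_type_push:
  assumes "ring_of_type X R c" shows "ring_of_type Y (h ` R) (h \<circ> c)"
proof -
  have "core_curve a l (h \<circ> u) = h \<circ> core_curve a l u" for a l u
    by (simp add: core_curve_def fun_eq_iff)
  then show ?thesis
    using assms cylinder_map_push curve_homotopic_push unfolding ring_of_type_def by metis
qed

lemma simple_closed_curve_push: "simple_closed_curve X c \<Longrightarrow> simple_closed_curve Y (h \<circ> c)"
  unfolding simple_closed_curve_def
proof (elim conjE, intro conjI)
  assume c: "continuous_map circle (topol X) c" and inj: "inj_on c (sphere 0 1)"
  show "continuous_map circle (topol Y) (h \<circ> c)"
    using c cont by (rule continuous_map_compose)
  have "c ` sphere 0 1 \<subseteq> points X"
    using c unfolding continuous_map_def by auto
  then show "inj_on (h \<circ> c) (sphere 0 1)"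
    using inj inj_h by (blast intro: comp_inj_on inj_on_subset)
qed

lemma rectifiable_curve_push:
  assumes c: "simple_closed_curve X c" and r: "rectifiable_curve X c"
  shows "rectifiable_curve Y (h \<circ> c)"
  unfolding rectifiable_curve_def
proof (intro ballI, safe)
  fix V w a b assume d: "(V, w) \<in> charts Y" and ab: "a \<le> (b::real)"
    and im: "(\<lambda>t. (h \<circ> c) (cis t)) ` {a..b} \<subseteq> V"
  have "c (cis t) \<in> points X" for t
    using c unfolding simple_closed_curve_def continuous_map_def by auto
  then have "(\<lambda>t. c (cis t)) ` {a..b} \<subseteq> h' ` V"
    using im mem_pull[OF d] by fastforce
  then have "abs_continuous_on a b (\<lambda>t. (w \<circ> h) (c (cis t)))"
    using r pull_chart[OF d] ab unfolding rectifiable_curve_def by blast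
  then show "abs_continuous_on a b (\<lambda>t. w ((h \<circ> c) (cis t)))" by simp
qed

end

section \<open>Transport of quadratic differentials\<close>

text \<open>Both directions are assumed because \<open>z \<circ> h' \<circ> h\<close> agrees with
  \<open>z\<close> only on the surface, so neither condition is formally the other read backwards.
  Fixing the value 0 outside the atlases makes the two differentials, as total functions, determine
  each other.\<close>

locale qdiff_iso = surface_iso X Y h h'
  for X :: "'b surface" and Y :: "'c surface" and h h' +
  fixes \<phi> :: "'b qdiff" and \<psi> :: "'c qdiff"
  assumes push_qdiff: "(U, z) \<in> charts X \<Longrightarrow> \<psi> (h ` U, z \<circ> h') = \<phi> (U, z)"
    and pull_qdiff: "(V, w) \<in> charts Y \<Longrightarrow> \<phi> (h' ` V, w \<circ> h) = \<psi> (V, w)"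
    and off_X: "\<And>c. c \<notin> charts X \<Longrightarrow> \<phi> c = (\<lambda>_. 0)"
    and off_Y: "\<And>c. c \<notin> charts Y \<Longrightarrow> \<psi> c = (\<lambda>_. 0)"

context qdiff_iso
begin

lemma swap_q: "qdiff_iso Y X h' h \<psi> \<phi>"
  by (intro qdiff_iso.intro swap qdiff_iso_axioms.intro)
    (auto intro: push_qdiff pull_qdiff off_X off_Y)

lemma zero_imp: "\<psi> = zero_qdiff \<Longrightarrow> \<phi> = zero_qdiff"
  using push_qdiff off_X unfolding zero_qdiff_def fun_eq_iff by (metis prod.exhaust)

text \<open>Pushing charts forward may identify two charts that differ only off the surface; the
  corresponding disjoint sets then have equal images, so they are empty and contribute \<open>0\<close>.\<close>

lemma qnorm_le: "qnorm X \<phi> \<le> qnorm Y \<psi>"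
  unfolding qnorm_def[of X]
proof (rule Sup_least, clarify)
  fix D :: "('b chart \<times> 'b set) set"
  assume fin: "finite D"
    and D: "\<forall>((U, z), E)\<in>D. (U, z) \<in> charts X \<and> E \<subseteq> U \<and> z ` E \<in> sets borel"
    and disj: "pairwise (\<lambda>x y. snd x \<inter> snd y = {}) D"
  define P :: "'b chart \<times> 'b set \<Rightarrow> 'c chart \<times> 'c set"
    where "P = (\<lambda>((U, z), E). ((h ` U, z \<circ> h'), h ` E))"
  define I where "I = (\<lambda>((V, w), E). \<integral>\<^sup>+ x\<in>w ` E. ennreal (cmod (\<psi> (V, w) x)) \<partial>lborel)"
  have DE: "(U, z) \<in> charts X" "E \<subseteq> U" "z ` E \<in> sets borel" if "((U, z), E) \<in> D" for U z E
    using D that by auto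
  have sub: "snd x \<subseteq> points X" if "x \<in> D" for x
    using DE chart_X that by (metis prod.collapse subset_trans)
  have snd_P: "snd (P x) = h ` snd x" for x
    by (simp add: P_def split: prod.splits)
  have I_P: "I (P ((U, z), E)) = (\<integral>\<^sup>+ x\<in>z ` E. ennreal (cmod (\<phi> (U, z) x)) \<partial>lborel)"
    if "((U, z), E) \<in> D" for U z E
    using push_pull_image[OF DE(1,2)[OF that]] push_qdiff[OF DE(1)[OF that]]
    by (simp add: I_def P_def)
  have "(\<Sum>((U, z), E)\<in>D. \<integral>\<^sup>+ x\<in>z ` E. ennreal (cmod (\<phi> (U, z) x)) \<partial>lborel) = sum (I \<circ> P) D"
    by (rule sum.cong) (auto simp: I_P)
  also have "\<dots> = sum I (P ` D)"
  proof (rule sum.reindex_nontrivial[symmetric, OF fin])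
    fix x y assume xy: "x \<in> D" "y \<in> D" "x \<noteq> y" "P x = P y"
    then have "h ` snd x = h ` snd y" by (metis snd_P)
    then have "snd x = snd y" using h'_image_h sub xy(1,2) by metis
    then have "snd x = {}" using disj xy by (auto simp: pairwise_def)
    then have "snd (P x) = {}" by (simp add: snd_P)
    then show "I (P x) = 0" by (auto simp: I_def split: prod.splits)
  qed
  also have "\<dots> \<le> qnorm Y \<psi>"
    unfolding qnorm_def I_def
  proof (rule Sup_upper, rule CollectI, intro exI[of _ "P ` D"] conjI)
    show "finite (P ` D)" using fin by simp
    show "\<forall>((U, z), E)\<in>P ` D. (U, z) \<in> charts Y \<and> E \<subseteq> U \<and> z ` E \<in> sets borel"
    proof (rule ballI)
      fix y assume "y \<in> P ` D"
      then obtain U z E where y: "y = P ((U, z), E)" and x: "((U, z), E) \<in> D" by auto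
      show "(\<lambda>((U, z), E). (U, z) \<in> charts Y \<and> E \<subseteq> U \<and> z ` E \<in> sets borel) y"
        using push_chart[OF DE(1)[OF x]] push_pull_image[OF DE(1,2)[OF x]] DE[OF x]
        by (auto simp: y P_def)
    qed
    show "pairwise (\<lambda>x y. snd x \<inter> snd y = {}) (P ` D)"
    proof (rule pairwiseI)
      fix x y assume "x \<in> P ` D" "y \<in> P ` D" and ne: "x \<noteq> y"
      then obtain x' y' where xy: "x = P x'" "x' \<in> D" "y = P y'" "y' \<in> D" by auto
      then have "x' \<noteq> y'" using ne by blast
      with disj xy(2,4) have "snd x' \<inter> snd y' = {}" by (rule pairwiseD)
      then show "snd x \<inter> snd y = {}"
        using h_image_Int[OF sub[OF xy(2)] sub[OF xy(4)]] xy(1,3) by (simp add: snd_P)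
    qed
  qed simp
  finally show "(\<Sum>((U, z), E)\<in>D. \<integral>\<^sup>+ x\<in>z ` E. ennreal (cmod (\<phi> (U, z) x)) \<partial>lborel) \<le> qnorm Y \<psi>" .
qed

lemma qnorm_eq: "qnorm Y \<psi> = qnorm X \<phi>"
  using qnorm_le qdiff_iso.qnorm_le[OF swap_q] by simp

text \<open>The coefficient of \<open>\<psi>\<close> in a chart of \<open>Y\<close> is that of
  \<open>\<phi>\<close> in the pulled back chart, which has the same coordinate image and the same
  coordinate changes.\<close>

lemma quadratic_differential_push:
  assumes q: "quadratic_differential X \<phi>"
  shows "quadratic_differential Y \<psi>"
  unfolding quadratic_differential_def
proof (intro conjI allI impI ballI)
  have off: "\<phi> c x = 0" if "\<not> (c \<in> charts X \<and> x \<in> snd c ` fst c)" for c x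
    using q that unfolding quadratic_differential_def by blast
  have hol: "\<phi> (U, z) holomorphic_on z ` U" if "(U, z) \<in> charts X" for U z
    using q that unfolding quadratic_differential_def by blast
  have trans: "\<phi> c x = \<phi> d (transition c d x) * (deriv (transition c d) x)\<^sup>2"
    if "c \<in> charts X" "d \<in> charts X" "x \<in> snd c ` (fst c \<inter> fst d)" for c d x
    using q that unfolding quadratic_differential_def by blast
  {
    fix c x assume c: "\<not> (c \<in> charts Y \<and> x \<in> snd c ` fst c)"
    obtain V w where Vw: "c = (V, w)" by force
    show "\<psi> c x = 0"
    proof (cases "c \<in> charts Y")
      case True
      then have "(V, w) \<in> charts Y" "x \<notin> w ` V" using c Vw by auto
      then have "\<phi> (h' ` V, w \<circ> h) x = 0"
        by (intro off) (auto simp del: o_apply image_comp simp: pull_image)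
      then show ?thesis using pull_qdiff \<open>(V, w) \<in> charts Y\<close> Vw by metis
    qed (simp add: off_Y)
  next
    fix c assume "c \<in> charts Y"
    then show "case c of (V, w) \<Rightarrow> \<psi> (V, w) holomorphic_on w ` V"
    proof safe
      fix V w assume c: "(V, w) \<in> charts Y"
      show "\<psi> (V, w) holomorphic_on w ` V"
        using hol[OF pull_chart[OF c]] unfolding pull_image[OF c] pull_qdiff[OF c] .
    qed
  next
    fix c d x assume c: "c \<in> charts Y" and d: "d \<in> charts Y" and x: "x \<in> snd c ` (fst c \<inter> fst d)"
    obtain V w V2 w2 where Vw: "c = (V, w)" "d = (V2, w2)" by force
    have c': "(V, w) \<in> charts Y" and d': "(V2, w2) \<in> charts Y" using c d Vw by auto
    define c2 where "c2 = (h' ` V, w \<circ> h)"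
    define d2 where "d2 = (h' ` V2, w2 \<circ> h)"
    have xV: "x \<in> w ` V" using x Vw by auto
    have eq: "transition c2 d2 y = transition c d y" if "y \<in> w ` V" for y
      using transition_pull[OF c' d' that] Vw c2_def d2_def by simp
    \<comment> \<open>Equality at the single point \<open>x\<close> would not determine the
      derivative; an open set of agreement does.\<close>
    have "open (w ` V)"
      using c' riemann_Y unfolding riemann_surface_def is_chart_def by fastforce
    then have "\<forall>\<^sub>F y in nhds x. transition c2 d2 y = transition c d y"
      using eq xV by (auto simp: eventually_nhds)
    then have "deriv (transition c2 d2) x = deriv (transition c d) x"
      by (rule deriv_cong_ev) simp
    moreover have "x \<in> snd c2 ` (fst c2 \<inter> fst d2)"
    proof -
      obtain q where "q \<in> V" "q \<in> V2" "x = w q" using x Vw by auto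
      then show ?thesis
        using hh' chart_Y[OF c'] unfolding c2_def d2_def by (intro image_eqI[of _ _ "h' q"]) auto
    qed
    then have "\<phi> c2 x = \<phi> d2 (transition c2 d2 x) * (deriv (transition c2 d2) x)\<^sup>2"
      using trans pull_chart[OF c'] pull_chart[OF d'] unfolding c2_def d2_def by blast
    moreover have "\<phi> c2 = \<psi> c" "\<phi> d2 = \<psi> d"
      using pull_qdiff[OF c'] pull_qdiff[OF d'] Vw c2_def d2_def by auto
    ultimately show "\<psi> c x = \<psi> d (transition c d x) * (deriv (transition c d) x)\<^sup>2"
      using eq[OF xV] by simp
  next
    show "qnorm Y \<psi> < \<infinity>"
      using q qnorm_eq unfolding quadratic_differential_def by simp
  }
qed

section \<open>Zeros, trajectories and the critical graph\<close>

lemma qzeros_subset: "qzeros X \<phi> \<subseteq> points X"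
  using chart_X unfolding qzeros_def by blast

lemma qzeros_push: "p \<in> qzeros X \<phi> \<Longrightarrow> h p \<in> qzeros Y \<psi>"
proof -
  assume "p \<in> qzeros X \<phi>"
  then obtain U z where c: "(U, z) \<in> charts X" "p \<in> U" "\<phi> (U, z) (z p) = 0"
    unfolding qzeros_def by blast
  then have "\<psi> (h ` U, z \<circ> h') ((z \<circ> h') (h p)) = 0"
    using push_qdiff h'h chart_X by (metis comp_apply subsetD)
  then show ?thesis
    using push_chart[OF c(1)] c(2) unfolding qzeros_def by blast
qed

lemma vertical_curve_subset: "vertical_curve X \<phi> \<gamma> \<Longrightarrow> range \<gamma> \<subseteq> points X"
  unfolding vertical_curve_def by blast

text \<open>In the pulled back chart the curve has the same coordinate expression and the
  differential the same coefficient, so the same local holomorphic function \<open>G\<close>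
  serves.\<close>

lemma vertical_curve_push:
  assumes v: "vertical_curve X \<phi> \<gamma>"
  shows "vertical_curve Y \<psi> (h \<circ> \<gamma>)"
  unfolding vertical_curve_def
proof (intro conjI allI ballI, safe)
  have pts: "\<gamma> t \<in> points X" for t using vertical_curve_subset[OF v] by blast
  show "(h \<circ> \<gamma>) t \<in> points Y" for t using in_Y pts by simp
  fix t V w assume c: "(V, w) \<in> charts Y" and t: "(h \<circ> \<gamma>) t \<in> V"
  have "\<gamma> t \<in> h' ` V" using t mem_pull[OF c pts] by simp
  then obtain G where G: "G analytic_on {complex_of_real t}"
    "\<forall>\<^sub>F s in nhds t. \<gamma> s \<in> h' ` V \<and> (w \<circ> h) (\<gamma> s) = G (complex_of_real s)"
    "let q = \<phi> (h' ` V, w \<circ> h) ((w \<circ> h) (\<gamma> t)) * (deriv G (complex_of_real t))\<^sup>2 in Im q = 0 \<and> Re q < 0"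
    using v pull_chart[OF c] unfolding vertical_curve_def by blast
  have "\<forall>\<^sub>F s in nhds t. (h \<circ> \<gamma>) s \<in> V \<and> w ((h \<circ> \<gamma>) s) = G (complex_of_real s)"
    using G(2) by eventually_elim (use mem_pull[OF c pts] in auto)
  moreover have "let q = \<psi> (V, w) (w ((h \<circ> \<gamma>) t)) * (deriv G (complex_of_real t))\<^sup>2 in Im q = 0 \<and> Re q < 0"
    using G(3) unfolding pull_qdiff[OF c] by simp
  ultimately show "\<exists>G. G analytic_on {complex_of_real t} \<and>
      (\<forall>\<^sub>F s in nhds t. (h \<circ> \<gamma>) s \<in> V \<and> w ((h \<circ> \<gamma>) s) = G (complex_of_real s)) \<and>
      (let q = \<psi> (V, w) (w ((h \<circ> \<gamma>) t)) * (deriv G (complex_of_real t))\<^sup>2 in Im q = 0 \<and> Re q < 0)"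
    using G(1) by blast
qed

lemma vertical_trajectory_subset: "vertical_trajectory X \<phi> T \<Longrightarrow> T \<subseteq> points X"
  using vertical_curve_subset unfolding vertical_trajectory_def by blast

text \<open>For maximality, a vertical curve on \<open>Y\<close> covering the image of
  \<open>T\<close> is pulled back by \<open>h'\<close>; maximality of \<open>T\<close> gives
  equality there, and \<open>h\<close> carries it back to \<open>Y\<close>.\<close>

lemma vertical_trajectory_push:
  assumes v: "vertical_trajectory X \<phi> T"
  shows "vertical_trajectory Y \<psi> (h ` T)"
  unfolding vertical_trajectory_def
proof (intro conjI allI impI)
  obtain \<gamma> where "vertical_curve X \<phi> \<gamma>" "T = range \<gamma>"
    using v unfolding vertical_trajectory_def by blast
  then show "\<exists>\<gamma>. vertical_curve Y \<psi> \<gamma> \<and> h ` T = range \<gamma>"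
    using vertical_curve_push by (intro exI[of _ "h \<circ> \<gamma>"]) (auto simp: image_comp)
next
  fix \<gamma> assume \<gamma>: "vertical_curve Y \<psi> \<gamma> \<and> h ` T \<subseteq> range \<gamma>"
  have "vertical_curve X \<phi> (h' \<circ> \<gamma>)"
    using \<gamma> qdiff_iso.vertical_curve_push[OF swap_q] by blast
  moreover have "T \<subseteq> h' ` range \<gamma>"
    using \<gamma> h'_image_h[OF vertical_trajectory_subset[OF v]] by (metis image_mono)
  ultimately have "h' ` range \<gamma> = T"
    using v unfolding vertical_trajectory_def by (metis image_comp)
  moreover have "range \<gamma> \<subseteq> points Y"
    using \<gamma> unfolding vertical_curve_def by blast
  ultimately show "range \<gamma> = h ` T" using h_image_h' by metis
qed

lemma closed_vertical_trajectory_push: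
  assumes "closed_vertical_trajectory X \<phi> T"
  shows "closed_vertical_trajectory Y \<psi> (h ` T)"
proof -
  obtain \<gamma> \<tau> where "\<tau> > 0" "vertical_curve X \<phi> \<gamma>" "T = range \<gamma>" "\<forall>t. \<gamma> (t + \<tau>) = \<gamma> t"
    using assms unfolding closed_vertical_trajectory_def by blast
  then have "vertical_curve Y \<psi> (h \<circ> \<gamma>) \<and> h ` T = range (h \<circ> \<gamma>) \<and> (\<forall>t. (h \<circ> \<gamma>) (t + \<tau>) = (h \<circ> \<gamma>) t)"
    using vertical_curve_push by (auto simp: image_comp)
  then show ?thesis
    using assms vertical_trajectory_push \<open>\<tau> > 0\<close> unfolding closed_vertical_trajectory_def by blast
qed

text \<open>A zero is a limit in the surface and is handled by continuity of \<open>h\<close>; a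
  puncture is not a point, and is handled by its chart. Verticality of the curve keeps it on the
  surface, where \<open>h'\<close> undoes \<open>h\<close>.\<close>

lemma tends_to_critical_push:
  assumes t: "tends_to_critical X \<phi> \<gamma> F" and v: "vertical_curve X \<phi> \<gamma>"
  shows "tends_to_critical Y \<psi> (h \<circ> \<gamma>) F"
  using t unfolding tends_to_critical_def[of X]
proof (elim disjE bexE exE conjE)
  fix p assume "p \<in> qzeros X \<phi>" "limitin (topol X) \<gamma> p F"
  then show ?thesis
    using qzeros_push continuous_map_limit[OF cont] unfolding tends_to_critical_def by blast
next
  fix U z assume c: "puncture_chart X (U, z)" and ev: "\<forall>\<^sub>F t in F. \<gamma> t \<in> U"
    and lim: "((\<lambda>t. z (\<gamma> t)) \<longlongrightarrow> 0) F"
  have "(\<lambda>t. (z \<circ> h') ((h \<circ> \<gamma>) t)) = (\<lambda>t. z (\<gamma> t))"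
    using vertical_curve_subset[OF v] h'h by (simp add: fun_eq_iff subset_iff)
  moreover have "\<forall>\<^sub>F t in F. (h \<circ> \<gamma>) t \<in> h ` U"
    using ev by eventually_elim auto
  ultimately show ?thesis
    using puncture_chart_push[OF c] lim unfolding tends_to_critical_def by metis
qed

lemma critical_graph_subset: "critical_graph X \<phi> \<subseteq> points X"
  using qzeros_subset vertical_trajectory_subset unfolding critical_graph_def by blast

lemma critical_graph_image_subset: "h ` critical_graph X \<phi> \<subseteq> critical_graph Y \<psi>"
proof (rule image_subsetI)
  fix p assume "p \<in> critical_graph X \<phi>"
  then consider "p \<in> qzeros X \<phi>"
    | \<gamma> where "vertical_trajectory X \<phi> (range \<gamma>)" "vertical_curve X \<phi> \<gamma>" "p \<in> range \<gamma>"
      "tends_to_critical X \<phi> \<gamma> at_bot" "tends_to_critical X \<phi> \<gamma> at_top"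
    unfolding critical_graph_def by blast
  then show "h p \<in> critical_graph Y \<psi>"
  proof cases
    case 1
    then show ?thesis using qzeros_push unfolding critical_graph_def by blast
  next
    case 2
    then have "vertical_trajectory Y \<psi> (range (h \<circ> \<gamma>))" "vertical_curve Y \<psi> (h \<circ> \<gamma>)"
      "h p \<in> range (h \<circ> \<gamma>)"
      "tends_to_critical Y \<psi> (h \<circ> \<gamma>) at_bot" "tends_to_critical Y \<psi> (h \<circ> \<gamma>) at_top"
      using vertical_trajectory_push[of "range \<gamma>"] vertical_curve_push[of \<gamma>] tends_to_critical_push[of \<gamma>]
      unfolding image_comp[symmetric] by blast+
    then show ?thesis unfolding critical_graph_def by blast
  qed
qed

lemma critical_graph_image: "critical_graph Y \<psi> = h ` critical_graph X \<phi>"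
proof
  have "h ` h' ` critical_graph Y \<psi> \<subseteq> h ` critical_graph X \<phi>"
    using qdiff_iso.critical_graph_image_subset[OF swap_q] by (rule image_mono)
  then show "critical_graph Y \<psi> \<subseteq> h ` critical_graph X \<phi>"
    using h_image_h' qdiff_iso.critical_graph_subset[OF swap_q] by simp
qed (rule critical_graph_image_subset)

text \<open>Since the critical graphs correspond, \<open>h\<close> restricts to a homeomorphism
  between their complements and carries components to components.\<close>

lemma characteristic_domains_image:
  "characteristic_domains Y \<psi> = (`) h ` characteristic_domains X \<phi>"
proof -
  let ?A = "points X - critical_graph X \<phi>" and ?B = "points Y - critical_graph Y \<psi>"
  have "h ` ?A = ?B"
    using inj_on_image_set_diff[OF inj_h, of "points X" "critical_graph X \<phi>"] critical_graph_subset
    by (auto simp: critical_graph_image image_points)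
  then have "homeomorphic_map (subtopology (topol X) ?A) (subtopology (topol Y) ?B) h"
    by (intro homeomorphic_map_subtopologies homeomorphic) (simp add: Int_absorb1)
  then show ?thesis
    unfolding characteristic_domains_def by (rule homeomorphic_map_connected_components_of)
qed

section \<open>Jenkins-Strebel differentials and lengths of curves\<close>

lemma jenkins_strebel_push:
  assumes j: "jenkins_strebel X \<phi>"
  shows "jenkins_strebel Y \<psi>"
  unfolding jenkins_strebel_def
proof (intro conjI ballI)
  show "quadratic_differential Y \<psi>" "\<psi> \<noteq> zero_qdiff"
    using j quadratic_differential_push zero_imp unfolding jenkins_strebel_def by blast+
  fix R' assume "R' \<in> characteristic_domains Y \<psi>"
  then obtain R where R: "R' = h ` R" "R \<in> characteristic_domains X \<phi>"
    using characteristic_domains_image by auto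
  then show "ring_domain Y R'"
    using j ring_domain_push unfolding jenkins_strebel_def by blast
  fix q assume "q \<in> R'"
  then obtain p where p: "p \<in> R" "q = h p" using R by blast
  then obtain T where "closed_vertical_trajectory X \<phi> T" "p \<in> T" "T \<subseteq> R"
    using j R(2) unfolding jenkins_strebel_def by blast
  then show "\<exists>T. closed_vertical_trajectory Y \<psi> T \<and> q \<in> T \<and> T \<subseteq> R'"
    using closed_vertical_trajectory_push p R(1) by blast
qed

text \<open>The speeds agree at every parameter, including those where the curve is not
  differentiable: \<open>qspeed\<close> is a definite description, and the predicates
  \<open>?P\<close> and \<open>?Q\<close> describing it are shown to be equal by pulling back and
  pushing forward charts.\<close>

lemma qlength_push:
  assumes c: "simple_closed_curve X c"
  shows "qlength Y \<psi> (h \<circ> c) = qlength X \<phi> c"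
proof -
  have pts: "c (cis t) \<in> points X" for t
    using c unfolding simple_closed_curve_def continuous_map_def by auto
  have "qspeed Y \<psi> (h \<circ> c) t = qspeed X \<phi> c t" for t
  proof -
    let ?P = "\<lambda>s. \<forall>(U, z)\<in>charts X. c (cis t) \<in> U \<longrightarrow>
      s = sqrt (cmod (\<phi> (U, z) (z (c (cis t))))) * cmod (vector_derivative (\<lambda>t. z (c (cis t))) (at t))"
    let ?Q = "\<lambda>s. \<forall>(V, w)\<in>charts Y. (h \<circ> c) (cis t) \<in> V \<longrightarrow>
      s = sqrt (cmod (\<psi> (V, w) (w ((h \<circ> c) (cis t))))) *
        cmod (vector_derivative (\<lambda>t. w ((h \<circ> c) (cis t))) (at t))"
    have "?Q s" if P: "?P s" for s
    proof (intro ballI, safe)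
      fix V w assume d: "(V, w) \<in> charts Y" and t: "(h \<circ> c) (cis t) \<in> V"
      have "c (cis t) \<in> h' ` V" using t mem_pull[OF d pts] by simp
      with P pull_chart[OF d] have "s = sqrt (cmod (\<phi> (h' ` V, w \<circ> h) ((w \<circ> h) (c (cis t))))) *
          cmod (vector_derivative (\<lambda>t. (w \<circ> h) (c (cis t))) (at t))"
        by blast
      then show "s = sqrt (cmod (\<psi> (V, w) (w ((h \<circ> c) (cis t))))) *
          cmod (vector_derivative (\<lambda>t. w ((h \<circ> c) (cis t))) (at t))"
        unfolding pull_qdiff[OF d] by simp
    qed
    moreover have "?P s" if Q: "?Q s" for s
    proof (intro ballI, safe)
      fix U z assume d: "(U, z) \<in> charts X" and t: "c (cis t) \<in> U"
      have "(h \<circ> c) (cis t) \<in> h ` U" using t by simp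
      with Q push_chart[OF d] have "s = sqrt (cmod (\<psi> (h ` U, z \<circ> h') ((z \<circ> h') ((h \<circ> c) (cis t))))) *
          cmod (vector_derivative (\<lambda>t. (z \<circ> h') ((h \<circ> c) (cis t))) (at t))"
        by blast
      then show "s = sqrt (cmod (\<phi> (U, z) (z (c (cis t))))) *
          cmod (vector_derivative (\<lambda>t. z (c (cis t))) (at t))"
        unfolding push_qdiff[OF d] using h'h[OF pts] by simp
    qed
    ultimately have "?P = ?Q" by (intro ext iffI)
    then show ?thesis unfolding qspeed_def by simp
  qed
  then show ?thesis unfolding qlength_def by simp
qed

end

section \<open>Construction of the transported differential\<close>

context surface_iso
begin

text \<open>The coefficients of \<open>\<psi>\<close> are read off in the pulled back charts, so the
  \<open>pull_qdiff\<close> condition holds by construction. The work is in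
  \<open>push_qdiff\<close>: pushing a chart forward and then pulling it back replaces
  \<open>z\<close> by \<open>z \<circ> h' \<circ> h\<close>, and the transformation rule must show
  that \<open>\<phi>\<close> has the same coefficient in both.\<close>

lemma ex_qdiff_iso:
  assumes q: "quadratic_differential X \<phi>"
  obtains \<psi> where "qdiff_iso X Y h h' \<phi> \<psi>"
proof
  define \<psi> where "\<psi> = (\<lambda>(V, w). if (V, w) \<in> charts Y then \<phi> (h' ` V, w \<circ> h) else (\<lambda>_. 0))"
  have off: "\<phi> c x = 0" if "\<not> (c \<in> charts X \<and> x \<in> snd c ` fst c)" for c x
    using q that unfolding quadratic_differential_def by blast
  have push: "\<psi> (h ` U, z \<circ> h') = \<phi> (U, z)" if c: "(U, z) \<in> charts X" for U z
  proof (rule ext)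
    fix x
    let ?z = "z \<circ> h' \<circ> h"
    have U: "h' ` h ` U = U" using h'_image_h chart_X[OF c] by blast
    have zz: "?z p = z p" if "p \<in> U" for p using h'h chart_X[OF c] that by auto
    have c2: "(U, ?z) \<in> charts X" using pull_chart[OF push_chart[OF c]] U by simp
    have im: "?z ` U = z ` U" using zz by (metis image_cong)
    have "\<phi> (U, ?z) x = \<phi> (U, z) x"
    proof (cases "x \<in> z ` U")
      case True
      \<comment> \<open>The two coordinates agree on \<open>U\<close>, so the coordinate change is
        the identity near each point and its derivative is 1.\<close>
      have tr: "transition (U, ?z) (U, z) y = y" if "y \<in> z ` U" for y
      proof -
        obtain p where p: "p \<in> U" "y = z p" using \<open>y \<in> z ` U\<close> by blast
        then have "inv_into U ?z y = p"
          using inv_into_f_f[OF chart_inj[OF riemann_X c2] p(1)] zz by simp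
        then show ?thesis using p by (simp add: transition_def)
      qed
      have "open (z ` U)"
        using c riemann_X unfolding riemann_surface_def is_chart_def by fastforce
      then have "\<forall>\<^sub>F y in nhds x. transition (U, ?z) (U, z) y = y"
        using True tr by (auto simp: eventually_nhds)
      then have "deriv (transition (U, ?z) (U, z)) x = deriv (\<lambda>y. y) x"
        by (rule deriv_cong_ev) simp
      moreover have "x \<in> snd (U, ?z) ` (fst (U, ?z) \<inter> fst (U, z))" using True im by simp
      then have "\<phi> (U, ?z) x = \<phi> (U, z) (transition (U, ?z) (U, z) x) *
          (deriv (transition (U, ?z) (U, z)) x)\<^sup>2"
        using q c c2 unfolding quadratic_differential_def by blast
      ultimately show ?thesis using tr[OF True] by simp
    next
      \<comment> \<open>Off the common coordinate image both coefficients are 0 by the normalization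
        of differentials.\<close>
      case False
      then show ?thesis using off im by (metis fst_conv snd_conv)
    qed
    then show "\<psi> (h ` U, z \<circ> h') x = \<phi> (U, z) x"
      using push_chart[OF c] U by (simp add: \<psi>_def)
  qed
  show "qdiff_iso X Y h h' \<phi> \<psi>"
  proof (intro qdiff_iso.intro qdiff_iso_axioms.intro surface_iso_axioms)
    show "\<psi> (h ` U, z \<circ> h') = \<phi> (U, z)" if "(U, z) \<in> charts X" for U z
      using push that by blast
    show "\<phi> (h' ` V, w \<circ> h) = \<psi> (V, w)" if "(V, w) \<in> charts Y" for V w
      using that by (simp add: \<psi>_def)
    show "\<phi> c = (\<lambda>_. 0)" if "c \<notin> charts X" for c
      using off that by blast
    show "\<psi> c = (\<lambda>_. 0)" if "c \<notin> charts Y" for c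
      using that by (cases c) (simp add: \<psi>_def)
  qed
qed

end

text \<open>On the atlas of \<open>Y\<close> the values are prescribed by \<open>\<phi>\<close>,
  elsewhere they are 0. This transfers uniqueness of the extremal differential.\<close>

lemma qdiff_iso_unique:
  assumes "qdiff_iso X Y h h' \<phi> \<psi>\<^sub>1" "qdiff_iso X Y h h' \<phi> \<psi>\<^sub>2"
  shows "\<psi>\<^sub>1 = \<psi>\<^sub>2"
proof (rule ext)
  fix c
  show "\<psi>\<^sub>1 c = \<psi>\<^sub>2 c"
    using qdiff_iso.pull_qdiff[OF assms(1)] qdiff_iso.pull_qdiff[OF assms(2)]
      qdiff_iso.off_Y[OF assms(1)] qdiff_iso.off_Y[OF assms(2)]
    by (metis prod.exhaust)
qed

section \<open>Transport of curve families\<close>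

text \<open>In the alternative with reversed orientation the homotopy from \<open>c\<close> to
  \<open>d\<close> is first composed with conjugation, a continuous self-map of the circle.\<close>

lemma curve_homotopic_trans:
  assumes "curve_homotopic X a c" and cd: "homotopic_with (\<lambda>_. True) circle (topol X) c d"
  shows "curve_homotopic X a d"
proof -
  have "continuous_map circle circle cnj"
    by (auto simp: continuous_map_in_subtopology intro!: continuous_intros)
  then have "homotopic_with (\<lambda>_. True) circle (topol X) (c \<circ> cnj) (d \<circ> cnj)"
    by (rule homotopic_with_compose_continuous_map_right[OF cd]) auto
  then show ?thesis
    using assms homotopic_with_trans unfolding curve_homotopic_def by blast
qed

text \<open>The curves need only correspond up to homotopy, because \<open>h\<close> itself agrees
  with the change of marking only up to homotopy. These homotopies preserve orientation, as the
  marking provides them. Assuming both directions keeps the situation symmetric.\<close>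

locale family_iso = surface_iso X Y h h'
  for X :: "'b surface" and Y :: "'c surface" and h h' +
  fixes \<gamma> :: "'k \<Rightarrow> 'b loop" and \<delta> :: "'k \<Rightarrow> 'c loop"
  assumes push_family: "homotopic_with (\<lambda>_. True) circle (topol Y) (h \<circ> \<gamma> j) (\<delta> j)"
    and pull_family: "homotopic_with (\<lambda>_. True) circle (topol X) (h' \<circ> \<delta> j) (\<gamma> j)"
begin

lemma swap_f: "family_iso Y X h' h \<delta> \<gamma>"
  by (intro family_iso.intro swap family_iso_axioms.intro push_family pull_family)

lemma curve_push: "curve_homotopic X c (\<gamma> j) \<Longrightarrow> curve_homotopic Y (h \<circ> c) (\<delta> j)"
  using curve_homotopic_push curve_homotopic_trans push_family by blast

lemma family_of_type_push:
  assumes "family_of_type X J \<gamma> R"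
  shows "family_of_type Y J \<delta> (\<lambda>j. h ` R j)"
  unfolding family_of_type_def
proof (intro ballI)
  fix j assume "j \<in> J"
  then have "R j = {} \<or> ring_of_type X (R j) (\<gamma> j)"
    using assms unfolding family_of_type_def by blast
  moreover have "ring_of_type Y (h ` R j) (\<delta> j)" if "ring_of_type X (R j) (\<gamma> j)"
    using ring_of_type_push[OF that] curve_homotopic_trans[OF _ push_family]
    unfolding ring_of_type_def by blast
  ultimately show "h ` R j = {} \<or> ring_of_type Y (h ` R j) (\<delta> j)" by blast
qed

lemma family_subset: "family_of_type X J \<gamma> R \<Longrightarrow> j \<in> J \<Longrightarrow> R j \<subseteq> points X"
  using cylinder_map_subset unfolding family_of_type_def ring_of_type_def by blast

lemma non_overlapping_push:
  assumes "family_of_type X J \<gamma> R" "non_overlapping J R"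
  shows "non_overlapping J (\<lambda>j. h ` R j)"
  using assms family_subset h_image_Int unfolding non_overlapping_def by (metis image_empty)

text \<open>Each competing curve on \<open>X\<close> is carried to a competing curve on
  \<open>Y\<close> of the same length.\<close>

lemma inf_length_le:
  assumes "qdiff_iso X Y h h' \<phi> \<psi>"
  shows "inf_length Y \<psi> (\<delta> j) \<le> inf_length X \<phi> (\<gamma> j)"
  unfolding inf_length_def[of X]
proof (rule Inf_greatest, clarify)
  fix c assume c: "simple_closed_curve X c" "curve_homotopic X c (\<gamma> j)" "rectifiable_curve X c"
  have "inf_length Y \<psi> (\<delta> j) \<le> qlength Y \<psi> (h \<circ> c)"
    unfolding inf_length_def
    using simple_closed_curve_push rectifiable_curve_push curve_push c by (intro Inf_lower) blast
  then show "inf_length Y \<psi> (\<delta> j) \<le> qlength X \<phi> c"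
    using qdiff_iso.qlength_push[OF assms c(1)] by simp
qed

lemma inf_length_eq:
  assumes "qdiff_iso X Y h h' \<phi> \<psi>"
  shows "inf_length Y \<psi> (\<delta> j) = inf_length X \<phi> (\<gamma> j)"
  using inf_length_le[OF assms] family_iso.inf_length_le[OF swap_f qdiff_iso.swap_q[OF assms]]
  by (rule antisym)

section \<open>Extremal differentials\<close>

lemma characteristic_family_push:
  assumes q: "qdiff_iso X Y h h' \<phi> \<psi>" and R: "characteristic_family X J \<gamma> \<phi> R"
  shows "characteristic_family Y J \<delta> \<psi> (\<lambda>j. h ` R j)"
proof -
  have "{h ` R j | j. j \<in> J \<and> h ` R j \<noteq> {}} = (`) h ` {R j | j. j \<in> J \<and> R j \<noteq> {}}"
    by blast
  then show ?thesis
    using R family_of_type_push non_overlapping_push qdiff_iso.characteristic_domains_image[OF q]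
    unfolding characteristic_family_def by auto
qed

lemma JS_of_type_push:
  "qdiff_iso X Y h h' \<phi> \<psi> \<Longrightarrow> JS_of_type X J \<gamma> \<phi> \<Longrightarrow> JS_of_type Y J \<delta> \<psi>"
  using characteristic_family_push qdiff_iso.jenkins_strebel_push unfolding JS_of_type_def by blast

text \<open>Maximality is tested by pulling a competing family on \<open>Y\<close> back to
  \<open>X\<close>: moduli, type and disjointness are preserved by \<open>h'\<close>, so the
  maximality on \<open>X\<close> applies to it.\<close>

lemma extremal_JS_push:
  assumes q: "qdiff_iso X Y h h' \<phi> \<psi>" and e: "extremal_JS X J \<gamma> A \<phi>"
  shows "extremal_JS Y J \<delta> A \<psi>"
proof -
  obtain R where js: "jenkins_strebel X \<phi>" and R: "characteristic_family X J \<gamma> \<phi> R"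
    and max: "\<And>R'. family_of_type X J \<gamma> R' \<Longrightarrow> non_overlapping J R' \<Longrightarrow>
      (\<Sum>j\<in>J. (A j)\<^sup>2 * modulus X (R' j)) \<le> (\<Sum>j\<in>J. (A j)\<^sup>2 * modulus X (R j))"
    and len: "\<forall>j\<in>J. (modulus X (R j) > 0 \<longrightarrow> ennreal (A j) = inf_length X \<phi> (\<gamma> j)) \<and>
      (modulus X (R j) = 0 \<longrightarrow> ennreal (A j) \<le> inf_length X \<phi> (\<gamma> j))"
    using e unfolding extremal_JS_def by blast
  have mod: "modulus Y (h ` R j) = modulus X (R j)" if "j \<in> J" for j
  proof -
    have "family_of_type X J \<gamma> R" using R unfolding characteristic_family_def by blast
    then show ?thesis using family_subset[OF _ that] by (intro modulus_push)
  qed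
  have sum_R: "(\<Sum>j\<in>J. (A j)\<^sup>2 * modulus Y (h ` R j)) = (\<Sum>j\<in>J. (A j)\<^sup>2 * modulus X (R j))"
    by (rule sum.cong) (auto simp: mod)
  have "(\<Sum>j\<in>J. (A j)\<^sup>2 * modulus Y (R' j)) \<le> (\<Sum>j\<in>J. (A j)\<^sup>2 * modulus Y (h ` R j))"
    if R': "family_of_type Y J \<delta> R'" "non_overlapping J R'" for R'
  proof -
    have "modulus X (h' ` R' j) = modulus Y (R' j)" if "j \<in> J" for j
      using surface_iso.modulus_push[OF swap] family_iso.family_subset[OF swap_f R'(1) that] by blast
    then have "(\<Sum>j\<in>J. (A j)\<^sup>2 * modulus Y (R' j)) = (\<Sum>j\<in>J. (A j)\<^sup>2 * modulus X (h' ` R' j))"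
      by (intro sum.cong) auto
    then show ?thesis
      using max[OF family_iso.family_of_type_push[OF swap_f R'(1)]
          family_iso.non_overlapping_push[OF swap_f R']] sum_R by simp
  qed
  moreover have "\<forall>j\<in>J. (modulus Y (h ` R j) > 0 \<longrightarrow> ennreal (A j) = inf_length Y \<psi> (\<delta> j)) \<and>
      (modulus Y (h ` R j) = 0 \<longrightarrow> ennreal (A j) \<le> inf_length Y \<psi> (\<delta> j))"
    using len mod inf_length_eq[OF q] by simp
  ultimately show ?thesis
    using qdiff_iso.jenkins_strebel_push[OF q js] characteristic_family_push[OF q R]
    unfolding extremal_JS_def by blast
qed

text \<open>Uniqueness needs the way back: a rival \<open>\<psi>'\<close> yields an extremal
  differential on \<open>X\<close>, which must be \<open>\<phi>\<close>, and \<open>\<phi>\<close>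
  determines its partner on \<open>Y\<close>.\<close>

lemma ex1_extremal_JS_push:
  assumes \<phi>: "extremal_JS X J \<gamma> A \<phi>" and uniq: "\<And>\<phi>'. extremal_JS X J \<gamma> A \<phi>' \<Longrightarrow> \<phi>' = \<phi>"
  obtains \<psi> where "qdiff_iso X Y h h' \<phi> \<psi>" "extremal_JS Y J \<delta> A \<psi>"
    "\<And>\<psi>'. extremal_JS Y J \<delta> A \<psi>' \<Longrightarrow> \<psi>' = \<psi>"
proof -
  have "quadratic_differential X \<phi>"
    using \<phi> unfolding extremal_JS_def jenkins_strebel_def by blast
  then obtain \<psi> where q: "qdiff_iso X Y h h' \<phi> \<psi>" by (rule ex_qdiff_iso)
  show ?thesis
  proof (rule that[OF q])
    show "extremal_JS Y J \<delta> A \<psi>" using extremal_JS_push[OF q \<phi>] .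
    fix \<psi>' assume e: "extremal_JS Y J \<delta> A \<psi>'"
    then have "quadratic_differential Y \<psi>'"
      unfolding extremal_JS_def jenkins_strebel_def by blast
    then obtain \<phi>' where q': "qdiff_iso Y X h' h \<psi>' \<phi>'" by (rule surface_iso.ex_qdiff_iso[OF swap])
    have "\<phi>' = \<phi>" using uniq family_iso.extremal_JS_push[OF swap_f q' e] .
    then show "\<psi>' = \<psi>" using qdiff_iso_unique[OF q] qdiff_iso.swap_q[OF q'] by blast
  qed
qed

end

section \<open>The surface of circumferences\<close>

lemma qnorm_zero_qdiff: "qnorm X zero_qdiff = 0"
proof -
  have "qnorm X zero_qdiff \<le> 0"
    unfolding qnorm_def by (rule Sup_least) (auto simp: zero_qdiff_def split: prod.splits intro!: sum.neutral)
  then show ?thesis by simp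
qed

text \<open>The same weights \<open>A\<close> serve on both surfaces, so a point of the first set
  reappears with unchanged coordinates in the second. Exchanging the surfaces gives the other
  inclusion.\<close>

lemma circumference_surface_subset:
  fixes \<gamma> :: "'k::finite \<Rightarrow> 'b loop" and \<delta> :: "'k \<Rightarrow> 'c loop"
  assumes "family_iso X Y h h' \<gamma> \<delta>"
  shows "circumference_surface X \<gamma> \<subseteq> circumference_surface Y \<delta>"
proof -
  interpret family_iso X Y h h' \<gamma> \<delta> by fact
  have "F_map Y \<delta> A \<in> JS0 Y \<delta>" if F: "F_map X \<gamma> A \<in> JS0 X \<gamma>" for A
  proof -
    let ?J = "{j. A $ j > 0}"
    have norm: "qnorm X (F_map X \<gamma> A) = 1" and JS: "F_map X \<gamma> A \<in> JS X \<gamma>"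
      using F unfolding JS0_def by auto
    \<comment> \<open>The default value of \<open>F_map\<close> has norm 0 and not 1, so the test of
      unique existence in its definition must have succeeded.\<close>
    then have nz: "F_map X \<gamma> A \<noteq> zero_qdiff" by (metis qnorm_zero_qdiff zero_neq_one)
    then have Jex: "?J \<noteq> {} \<and> (\<exists>!\<phi>. extremal_JS X ?J \<gamma> (($) A) \<phi>)"
      unfolding F_map_def Let_def by (rule contrapos_np) (rule if_not_P)
    note J = conjunct1[OF Jex] and ex = conjunct2[OF Jex]
    from ex obtain \<phi> where \<phi>: "extremal_JS X ?J \<gamma> (($) A) \<phi>"
      "\<And>\<phi>'. extremal_JS X ?J \<gamma> (($) A) \<phi>' \<Longrightarrow> \<phi>' = \<phi>" by (rule ex1E) blast
    have F\<phi>: "F_map X \<gamma> A = \<phi>"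
      unfolding F_map_def Let_def if_P[OF Jex] using \<phi> by (rule the_equality)
    obtain \<psi> where \<psi>: "qdiff_iso X Y h h' \<phi> \<psi>" "extremal_JS Y ?J \<delta> (($) A) \<psi>"
      "\<And>\<psi>'. extremal_JS Y ?J \<delta> (($) A) \<psi>' \<Longrightarrow> \<psi>' = \<psi>"
      using ex1_extremal_JS_push[OF \<phi>] by metis
    have "?J \<noteq> {} \<and> (\<exists>!\<psi>. extremal_JS Y ?J \<delta> (($) A) \<psi>)"
      using J \<psi>(2,3) by (intro conjI ex1I)
    then have "F_map Y \<delta> A = (THE \<psi>. extremal_JS Y ?J \<delta> (($) A) \<psi>)"
      unfolding F_map_def Let_def by (rule if_P)
    also have "\<dots> = \<psi>" using \<psi>(2,3) by (rule the_equality)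
    finally have "F_map Y \<delta> A = \<psi>" .
    \<comment> \<open>Membership in \<open>JS\<close> refers to the full family, whereas extremality
      refers to the indices of positive weight; both are transported to the same
      \<open>\<psi>\<close>.\<close>
    moreover have "JS_of_type X UNIV \<gamma> \<phi>" using JS nz F\<phi> unfolding JS_def by blast
    ultimately show ?thesis
      using JS_of_type_push[OF \<psi>(1)] qdiff_iso.qnorm_eq[OF \<psi>(1)] norm F\<phi>
      unfolding JS0_def JS_def by simp
  qed
  then show ?thesis unfolding circumference_surface_def by blast
qed

theorem corollary4p2:
  fixes S :: "'a surface" and g n :: nat
    and \<gamma> :: "'k::finite \<Rightarrow> 'a loop"
    and S\<^sub>1 :: "'b surface" and f\<^sub>1 :: "'a \<Rightarrow> 'b"
    and S\<^sub>2 :: "'c surface" and f\<^sub>2 :: "'a \<Rightarrow> 'c"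
  assumes "surface_of_type S g n" and "3 * g + n > 3"
    and "admissible_family S \<gamma>"
    and "marked_surface S S\<^sub>1 f\<^sub>1" and "marked_surface S S\<^sub>2 f\<^sub>2"
    and "teichmueller_equiv S S\<^sub>1 f\<^sub>1 S\<^sub>2 f\<^sub>2"
  shows "circumference_surface S\<^sub>1 (\<lambda>j. f\<^sub>1 \<circ> \<gamma> j) = circumference_surface S\<^sub>2 (\<lambda>j. f\<^sub>2 \<circ> \<gamma> j)"
proof -
  have S12: "riemann_surface S\<^sub>1" "riemann_surface S\<^sub>2"
    and f\<^sub>1: "homeomorphic_map (topol S) (topol S\<^sub>1) f\<^sub>1"
    using assms(4,5) unfolding marked_surface_def quasiconformal_def by auto
  obtain h where conf: "conformal_map S\<^sub>1 S\<^sub>2 h"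
    and hom: "homotopic_with (\<lambda>_. True) (topol S\<^sub>1) (topol S\<^sub>2) h (f\<^sub>2 \<circ> inv_into (points S) f\<^sub>1)"
    using assms(6) unfolding teichmueller_equiv_def by blast
  obtain h' where iso: "surface_iso S\<^sub>1 S\<^sub>2 h h'"
    using conformal_map_imp_surface_iso[OF S12 conf] .
  interpret surface_iso S\<^sub>1 S\<^sub>2 h h' by (rule iso)
  have \<gamma>: "continuous_map circle (topol S) (\<gamma> j)" for j
    using assms(3) unfolding admissible_family_def simple_closed_curve_def by blast
  have f\<gamma>: "continuous_map circle (topol S\<^sub>1) (f\<^sub>1 \<circ> \<gamma> j)" for j
    using \<gamma> homeomorphic_imp_continuous_map[OF f\<^sub>1] by (rule continuous_map_compose)
  have push: "homotopic_with (\<lambda>_. True) circle (topol S\<^sub>2) (h \<circ> (f\<^sub>1 \<circ> \<gamma> j)) (f\<^sub>2 \<circ> \<gamma> j)" for j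
  proof -
    have "homotopic_with (\<lambda>_. True) circle (topol S\<^sub>2) (h \<circ> (f\<^sub>1 \<circ> \<gamma> j))
        ((f\<^sub>2 \<circ> inv_into (points S) f\<^sub>1) \<circ> (f\<^sub>1 \<circ> \<gamma> j))"
      by (rule homotopic_with_compose_continuous_map_right[OF hom f\<gamma>]) auto
    \<comment> \<open>The factor \<open>inv_into\<close> undoes the first marking only on the points
      of \<open>S\<close>; this suffices, as the homotopy depends only on values on the
      circle.\<close>
    moreover have "((f\<^sub>2 \<circ> inv_into (points S) f\<^sub>1) \<circ> (f\<^sub>1 \<circ> \<gamma> j)) \<zeta> = (f\<^sub>2 \<circ> \<gamma> j) \<zeta>" if "\<zeta> \<in> sphere 0 1" for \<zeta>
      using inv_into_f_f[OF homeomorphic_imp_injective_map[OF f\<^sub>1], of "\<gamma> j \<zeta>"] \<gamma>[of j] that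
      by (auto simp: continuous_map_def Pi_iff)
    ultimately show ?thesis
      by (elim homotopic_with_eq) auto
  qed
  \<comment> \<open>Applying \<open>h'\<close> to the homotopy \<open>push\<close> gives the one on
    the first surface, since \<open>h'\<close> after \<open>h\<close> fixes its points.\<close>
  have pull: "homotopic_with (\<lambda>_. True) circle (topol S\<^sub>1) (h' \<circ> (f\<^sub>2 \<circ> \<gamma> j)) (f\<^sub>1 \<circ> \<gamma> j)" for j
  proof -
    have "homotopic_with (\<lambda>_. True) circle (topol S\<^sub>1) (h' \<circ> (h \<circ> (f\<^sub>1 \<circ> \<gamma> j))) (h' \<circ> (f\<^sub>2 \<circ> \<gamma> j))"
      using surface_iso.homotopic_push[OF swap push] .
    moreover have "(f\<^sub>1 \<circ> \<gamma> j) \<zeta> = (h' \<circ> (h \<circ> (f\<^sub>1 \<circ> \<gamma> j))) \<zeta>" if "\<zeta> \<in> sphere 0 1" for \<zeta>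
      using h'h f\<gamma>[of j] that by (auto simp: continuous_map_def Pi_iff)
    ultimately have "homotopic_with (\<lambda>_. True) circle (topol S\<^sub>1) (f\<^sub>1 \<circ> \<gamma> j) (h' \<circ> (f\<^sub>2 \<circ> \<gamma> j))"
      by (elim homotopic_with_eq) auto
    then show ?thesis by (rule homotopic_with_symD)
  qed
  have "family_iso S\<^sub>1 S\<^sub>2 h h' (\<lambda>j. f\<^sub>1 \<circ> \<gamma> j) (\<lambda>j. f\<^sub>2 \<circ> \<gamma> j)"
    by (intro family_iso.intro iso family_iso_axioms.intro push pull)
  then show ?thesis
    using circumference_surface_subset family_iso.swap_f by (metis subset_antisym)
qed

end
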